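(* For every $R>0$ there exists $T=T(R)>0$ such that for every $u_0\in L^2(\mathbb{R}^2)$ with $\|u_0\|_{L^2_x}\le R$ there exists a unique strong solution $u\in C^0([0,T),L^2(\mathbb{R}^2))$ to the Cauchy problem $$\partial_t u-ih(D)u=A(D)\big(|P_{\le M}u|^2P_{\le M}u\big),\qquad u(0,x)=u_0,$$ and the solution map $$B_{L^2_x}(0,R)\to C^0([0,T),L^2_x),\qquad u_0\mapsto u,$$ is Lipschitz continuous.
   Context: Setting. Fix $\delta\in(0,1)$, a positive integer $\beta$, and a smooth function $\gamma:(1-\delta,1+\delta)\to\mathbb{R}$ such that $|\gamma'(r)|\approx 1$ and $|\gamma''(r)|\approx|r-1|^{\beta}$ for all $r\in(1-\delta,1+\delta)$ (here $X\approx Y$ means $c^{-1}Y\le X\le cY$ with a constant $c>0$ independent of $r$). $h:\mathbb{R}^2\to\mathbb{R}$ is a radial (measurable) function with $h(\xi)=\gamma(|\xi|)$ whenever $|\xi|\in(1-\delta,1+\delta)$. $M<-100$ is an integer with $2^{M+4}<\delta$. For a symbol $m$, $m(D)$ is the Fourier multiplier $\widehat{m(D)f}=m\widehat f$ on $\mathbb{R}^2$, and $\{e^{ith(D)}\}$ is the corresponding unitary group on $L^2(\mathbb{R}^2)$. $\chi:\mathbb{R}\to[0,1]$ is a fixed smooth function with $\chi(r)=1$ for $|r|\le 1/2$ and $\chi(r)=0$ for $|r|\ge 3/4$, and $P_{\le M}$ is the Fourier multiplier with symbol $\chi(2^{-M}(|\xi|-1))$. $A(D)$ is a Fourier multiplier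 whose symbol satisfies $|A(\xi)|\lesssim \big||\xi|-1\big|^{\beta/2}$ for $|\xi|\in(1-\delta,1+\delta)$ and $\operatorname{supp}A\subset\{\xi\in\mathbb{R}^2:1-2^{M-1}<|\xi|<1+2^{M-1}\}$. A strong solution on $[0,T)$ is a function $u\in C^0([0,T),L^2_x)$ satisfying for $t\in[0,T)$ $$u(t)=e^{ith(D)}u_0+\int_0^t e^{i(t-s)h(D)}A(D)\big(|P_{\le M}u(s)|^2P_{\le M}u(s)\big)\,ds.$$ $B_{L^2_x}(0,R)$ is the closed ball of radius $R$ in $L^2(\mathbb{R}^2)$; $C^0([0,T),L^2_x)$ carries the supremum norm. *)

theory Defs
  imports "HOL-Analysis.Analysis"
begin

section \<open>The space \<open>L\<^sup>2\<close> of complex-valued functions modulo null sets\<close>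

definition square_integrable :: "('a::euclidean_space \<Rightarrow> complex) \<Rightarrow> bool" where
  "square_integrable f \<longleftrightarrow>
     f \<in> borel_measurable lebesgue \<and> integrable lebesgue (\<lambda>x. (cmod (f x))\<^sup>2)"

definition L2_rel :: "('a::euclidean_space \<Rightarrow> complex) \<Rightarrow> ('a \<Rightarrow> complex) \<Rightarrow> bool" where
  "L2_rel f g \<longleftrightarrow> square_integrable f \<and> square_integrable g \<and> (AE x in lebesgue. f x = g x)"

lemma square_integrable_zero: "square_integrable (\<lambda>x. 0)"
  by (simp add: square_integrable_def)

lemma square_integrable_scale:
  assumes "square_integrable f"
  shows "square_integrable (\<lambda>x. c * f x)"
  using assms by (auto simp: square_integrable_def norm_mult power_mult_distrib)

lemma square_integrable_add:
  assumes "square_integrable f" "square_integrable g"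
  shows "square_integrable (\<lambda>x. f x + g x)"
proof -
  have [measurable]: "f \<in> borel_measurable lebesgue" "g \<in> borel_measurable lebesgue"
    and i: "integrable lebesgue (\<lambda>x. 2 * (cmod (f x))\<^sup>2 + 2 * (cmod (g x))\<^sup>2)"
    using assms by (auto simp: square_integrable_def)
  have b: "(cmod (f x + g x))\<^sup>2 \<le> 2 * (cmod (f x))\<^sup>2 + 2 * (cmod (g x))\<^sup>2" for x
  proof -
    have "(cmod (f x + g x))\<^sup>2 \<le> (cmod (f x) + cmod (g x))\<^sup>2"
      by (intro power_mono norm_triangle_ineq) auto
    also have "\<dots> \<le> 2 * (cmod (f x))\<^sup>2 + 2 * (cmod (g x))\<^sup>2"
      using sum_squares_bound[of "cmod (f x)" "cmod (g x)"] by (simp add: power2_sum)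
    finally show ?thesis .
  qed
  have "integrable lebesgue (\<lambda>x. (cmod (f x + g x))\<^sup>2)"
    by (rule Bochner_Integration.integrable_bound[OF i]) (use b in \<open>auto intro!: AE_I2\<close>)
  then show ?thesis by (simp add: square_integrable_def)
qed

lemma square_integrable_uminus:
  "square_integrable f \<Longrightarrow> square_integrable (\<lambda>x. - f x)"
  by (auto simp: square_integrable_def)

lemma square_integrable_diff:
  "square_integrable f \<Longrightarrow> square_integrable g \<Longrightarrow> square_integrable (\<lambda>x. f x - g x)"
  using square_integrable_add[of f "\<lambda>x. - g x"] square_integrable_uminus by auto

lemma square_integrable_scaleR:
  "square_integrable f \<Longrightarrow> square_integrable (\<lambda>x. c *\<^sub>R f x)"
  using square_integrable_scale[of f "of_real c"] by (simp add: scaleR_conv_of_real)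

definition L2_norm :: "('a::euclidean_space \<Rightarrow> complex) \<Rightarrow> real" where
  "L2_norm f = sqrt (LINT x|lebesgue. (cmod (f x))\<^sup>2)"

lemma L2_norm_triangle:
  assumes "square_integrable f" "square_integrable g"
  shows "L2_norm (\<lambda>x. f x + g x) \<le> L2_norm f + L2_norm g"
proof (rule field_le_epsilon)
  fix e :: real
  assume "e > 0"
  define a where "a = L2_norm f + e / 2"
  define b where "b = L2_norm g + e / 2"
  have nn: "L2_norm f \<ge> 0" "L2_norm g \<ge> 0"
    by (auto simp: L2_norm_def)
  then have pos: "a > 0" "b > 0"
    using \<open>e > 0\<close> by (auto simp: a_def b_def)
  have F: "(LINT x|lebesgue. (cmod (f x))\<^sup>2) = (L2_norm f)\<^sup>2"
    and G: "(LINT x|lebesgue. (cmod (g x))\<^sup>2) = (L2_norm g)\<^sup>2"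
    by (auto simp: L2_norm_def)
  have i: "integrable lebesgue (\<lambda>x. (cmod (f x))\<^sup>2)" "integrable lebesgue (\<lambda>x. (cmod (g x))\<^sup>2)"
      "integrable lebesgue (\<lambda>x. (cmod (f x + g x))\<^sup>2)"
    using assms square_integrable_add[OF assms] by (auto simp: square_integrable_def)
  have pt: "(cmod (f x + g x))\<^sup>2 \<le> (1 + b / a) * (cmod (f x))\<^sup>2 + (1 + a / b) * (cmod (g x))\<^sup>2" for x
  proof -
    let ?p = "cmod (f x)" and ?q = "cmod (g x)"
    have "0 \<le> (b * ?p - a * ?q)\<^sup>2 / (a * b)"
      using pos by simp
    also have "\<dots> = (b / a) * ?p\<^sup>2 + (a / b) * ?q\<^sup>2 - 2 * ?p * ?q"
      using pos by (simp add: power2_eq_square field_simps)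
    finally have *: "2 * ?p * ?q \<le> (b / a) * ?p\<^sup>2 + (a / b) * ?q\<^sup>2"
      by simp
    have "(cmod (f x + g x))\<^sup>2 \<le> (?p + ?q)\<^sup>2"
      by (intro power_mono norm_triangle_ineq) auto
    also have "\<dots> = ?p\<^sup>2 + ?q\<^sup>2 + 2 * ?p * ?q"
      by (simp add: power2_sum)
    finally show ?thesis
      using * by (simp add: algebra_simps)
  qed
  have "(LINT x|lebesgue. (cmod (f x + g x))\<^sup>2)
      \<le> (LINT x|lebesgue. (1 + b / a) * (cmod (f x))\<^sup>2 + (1 + a / b) * (cmod (g x))\<^sup>2)"
    by (intro integral_mono) (use i pt in auto)
  also have "\<dots> = (1 + b / a) * (L2_norm f)\<^sup>2 + (1 + a / b) * (L2_norm g)\<^sup>2"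
    using i by (simp add: F G)
  also have "\<dots> \<le> (1 + b / a) * a\<^sup>2 + (1 + a / b) * b\<^sup>2"
    using pos nn \<open>e > 0\<close> by (intro add_mono mult_left_mono power_mono) (auto simp: a_def b_def)
  also have "\<dots> = (a + b)\<^sup>2"
    using pos by (simp add: power2_eq_square field_simps)
  finally have "L2_norm (\<lambda>x. f x + g x) \<le> sqrt ((a + b)\<^sup>2)"
    unfolding L2_norm_def by (rule real_sqrt_le_mono)
  then show "L2_norm (\<lambda>x. f x + g x) \<le> L2_norm f + L2_norm g + e"
    using pos by (simp add: a_def b_def)
qed

lemma L2_norm_eq_0_iff:
  assumes "square_integrable f"
  shows "L2_norm f = 0 \<longleftrightarrow> (AE x in lebesgue. f x = 0)"
  using assms integral_nonneg_eq_0_iff_AE[of lebesgue "\<lambda>x. (cmod (f x))\<^sup>2"]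
  by (simp add: L2_norm_def square_integrable_def)

lemma L2_norm_cong_AE:
  assumes "square_integrable f" "square_integrable g" "AE x in lebesgue. f x = g x"
  shows "L2_norm f = L2_norm g"
proof -
  have [measurable]: "f \<in> borel_measurable lebesgue" "g \<in> borel_measurable lebesgue"
    using assms by (auto simp: square_integrable_def)
  have "AE x in lebesgue. (cmod (f x))\<^sup>2 = (cmod (g x))\<^sup>2"
    using assms(3) by auto
  then have "(LINT x|lebesgue. (cmod (f x))\<^sup>2) = (LINT x|lebesgue. (cmod (g x))\<^sup>2)"
    by (intro integral_cong_AE) auto
  then show ?thesis by (simp add: L2_norm_def)
qed

quotient_type (overloaded) 'a L2 = "'a::euclidean_space \<Rightarrow> complex" / partial: L2_rel
proof (rule part_equivpI)
  show "\<exists>f :: 'a \<Rightarrow> complex. L2_rel f f"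
    by (rule exI[of _ "\<lambda>x. 0"]) (simp add: L2_rel_def square_integrable_zero)
  show "symp L2_rel"
    by (auto simp: symp_def L2_rel_def)
  show "transp L2_rel"
    by (auto simp: transp_def L2_rel_def)
qed

instantiation L2 :: (euclidean_space) real_normed_vector
begin

lift_definition zero_L2 :: "'a L2" is "\<lambda>x. 0"
  by (simp add: L2_rel_def square_integrable_zero)

lift_definition plus_L2 :: "'a L2 \<Rightarrow> 'a L2 \<Rightarrow> 'a L2" is "\<lambda>f g x. f x + g x"
  by (auto simp: L2_rel_def square_integrable_add)

lift_definition uminus_L2 :: "'a L2 \<Rightarrow> 'a L2" is "\<lambda>f x. - f x"
  by (auto simp: L2_rel_def square_integrable_uminus)

lift_definition minus_L2 :: "'a L2 \<Rightarrow> 'a L2 \<Rightarrow> 'a L2" is "\<lambda>f g x. f x - g x"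
  by (auto simp: L2_rel_def square_integrable_diff)

lift_definition scaleR_L2 :: "real \<Rightarrow> 'a L2 \<Rightarrow> 'a L2" is "\<lambda>c f x. c *\<^sub>R f x"
  by (auto simp: L2_rel_def square_integrable_scaleR)

lift_definition norm_L2 :: "'a L2 \<Rightarrow> real" is L2_norm
  by (auto simp: L2_rel_def intro: L2_norm_cong_AE)

definition dist_L2 :: "'a L2 \<Rightarrow> 'a L2 \<Rightarrow> real" where
  "dist_L2 f g = norm (f - g)"

definition sgn_L2 :: "'a L2 \<Rightarrow> 'a L2" where
  "sgn_L2 f = inverse (norm f) *\<^sub>R f"

definition uniformity_L2 :: "('a L2 \<times> 'a L2) filter" where
  "uniformity_L2 = (INF e\<in>{0<..}. principal {(f, g). dist f g < e})"

definition open_L2 :: "'a L2 set \<Rightarrow> bool" where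
  "open_L2 U \<longleftrightarrow> (\<forall>f\<in>U. eventually (\<lambda>(f', g). f' = f \<longrightarrow> g \<in> U) uniformity)"

instance
proof
  fix f g h :: "'a L2" and c d :: real
  show "f + g + h = f + (g + h)"
    by transfer (auto simp: L2_rel_def square_integrable_add algebra_simps)
  show "f + g = g + f"
    by transfer (auto simp: L2_rel_def square_integrable_add algebra_simps)
  show "0 + f = f"
    by transfer (auto simp: L2_rel_def)
  show "- f + f = 0"
    by transfer (auto simp: L2_rel_def square_integrable_zero)
  show "f - g = f + - g"
    by transfer (auto simp: L2_rel_def square_integrable_add square_integrable_uminus square_integrable_diff)
  show "c *\<^sub>R (f + g) = c *\<^sub>R f + c *\<^sub>R g"
    by transfer (auto simp: L2_rel_def square_integrable_add square_integrable_scaleR scaleR_add_right)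
  show "(c + d) *\<^sub>R f = c *\<^sub>R f + d *\<^sub>R f"
    by transfer (auto simp: L2_rel_def square_integrable_add square_integrable_scaleR scaleR_add_left)
  show "c *\<^sub>R d *\<^sub>R f = (c * d) *\<^sub>R f"
    by transfer (auto simp: L2_rel_def square_integrable_scaleR)
  show "1 *\<^sub>R f = f"
    by transfer (auto simp: L2_rel_def)
  show "dist f g = norm (f - g)"
    by (rule dist_L2_def)
  show "sgn f = inverse (norm f) *\<^sub>R f"
    by (rule sgn_L2_def)
  show "(uniformity :: ('a L2 \<times> 'a L2) filter) = (INF e\<in>{0<..}. principal {(f, g). dist f g < e})"
    by (rule uniformity_L2_def)
  show "open U \<longleftrightarrow> (\<forall>f\<in>U. eventually (\<lambda>(f', g). f' = f \<longrightarrow> g \<in> U) uniformity)"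
    for U :: "'a L2 set"
    by (rule open_L2_def)
  show "norm f = 0 \<longleftrightarrow> f = 0"
    by transfer (auto simp: L2_rel_def square_integrable_zero L2_norm_eq_0_iff)
  show "norm (f + g) \<le> norm f + norm g"
    by transfer (auto simp: L2_rel_def intro: L2_norm_triangle)
  show "norm (c *\<^sub>R f) = \<bar>c\<bar> * norm f"
    by transfer (simp add: L2_norm_def power_mult_distrib real_sqrt_mult)
qed

end

section \<open>Fourier transform and Fourier multipliers\<close>

definition fourier_integral :: "('a::euclidean_space \<Rightarrow> complex) \<Rightarrow> 'a \<Rightarrow> complex" where
  "fourier_integral f \<xi> = (LINT x|lebesgue. cis (- (x \<bullet> \<xi>)) * f x)"

text \<open>The Fourier transform on \<open>L\<^sup>2\<close> is the unique bounded operator that is given by the Fourier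
  integral on \<open>L\<^sup>1 \<inter> L\<^sup>2\<close>. By Plancherel it exists, and the Fourier integral of a
  function in \<open>L\<^sup>1 \<inter> L\<^sup>2\<close> lies in \<open>L\<^sup>2\<close>, so that \<^term>\<open>abs_L2\<close> is only applied to
  square integrable functions here.\<close>

definition fourier_L2 :: "'a::euclidean_space L2 \<Rightarrow> 'a L2" where
  "fourier_L2 = (THE F. bounded_linear F \<and>
     (\<forall>f. integrable lebesgue f \<and> square_integrable f
        \<longrightarrow> F (abs_L2 f) = abs_L2 (fourier_integral f)))"

text \<open>A symbol is identified with its almost everywhere class. For \<open>m\<close> measurable and bounded,
  \<open>g\<close> exists for every \<open>f\<close>.\<close>

definition multiplier :: "('a::euclidean_space \<Rightarrow> complex) \<Rightarrow> 'a L2 \<Rightarrow> 'a L2" where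
  "multiplier m f = (THE g. AE \<xi> in lebesgue.
     rep_L2 (fourier_L2 g) \<xi> = m \<xi> * rep_L2 (fourier_L2 f) \<xi>)"

section \<open>The Cauchy problem\<close>

definition smooth_on :: "real set \<Rightarrow> (real \<Rightarrow> real) \<Rightarrow> bool" where
  "smooth_on S f \<longleftrightarrow> (\<forall>n. \<forall>r\<in>S. (deriv ^^ n) f differentiable at r)"

definition comparable_on :: "'a set \<Rightarrow> ('a \<Rightarrow> real) \<Rightarrow> ('a \<Rightarrow> real) \<Rightarrow> bool" where
  "comparable_on S X Y \<longleftrightarrow> (\<exists>c>0. \<forall>r\<in>S. inverse c * Y r \<le> X r \<and> X r \<le> c * Y r)"

definition propagator :: "(real^2 \<Rightarrow> real) \<Rightarrow> real \<Rightarrow> (real^2) L2 \<Rightarrow> (real^2) L2" where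
  "propagator h t = multiplier (\<lambda>\<xi>. exp (\<i> * of_real (t * h \<xi>)))"

definition P_le :: "(real \<Rightarrow> real) \<Rightarrow> int \<Rightarrow> (real^2) L2 \<Rightarrow> (real^2) L2" where
  "P_le chi M = multiplier (\<lambda>\<xi>. of_real (chi (2 powi (- M) * (norm \<xi> - 1))))"

text \<open>The function \<open>|f|\<^sup>2 f\<close> need not be in \<open>L\<^sup>2\<close> for general \<open>f\<close>, in which case the
  value of \<open>cubic f\<close> is irrelevant. It is in \<open>L\<^sup>2\<close> when \<open>f\<close> has compactly supported Fourier
  transform, because then \<open>f\<close> is bounded; \<open>cubic\<close> is only applied to such \<open>f\<close>.\<close>

definition cubic :: "(real^2) L2 \<Rightarrow> (real^2) L2" where
  "cubic f = abs_L2 (\<lambda>x. of_real ((cmod (rep_L2 f x))\<^sup>2) * rep_L2 f x)"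

text \<open>The condition \<^term>\<open>u \<in> extensional {0..<T}\<close> makes a function on \<open>[0,T)\<close> unique
  as a total function.\<close>

definition C0 :: "real \<Rightarrow> (real \<Rightarrow> 'b::topological_space) set" where
  "C0 T = {u \<in> extensional {0..<T}. continuous_on {0..<T} u}"

text \<open>The supremum distance takes values in \<open>[0,\<infinity>]\<close> since \<^const>\<open>C0\<close> contains unbounded functions.\<close>

definition C0_dist :: "real \<Rightarrow> (real \<Rightarrow> 'b::metric_space) \<Rightarrow> (real \<Rightarrow> 'b) \<Rightarrow> ereal" where
  "C0_dist T u v = (SUP t\<in>{0..<T}. ereal (dist (u t) (v t)))"

text \<open>The Duhamel formula. Its integral is required to exist; the integrand is a
  continuous function of \<open>s\<close>.\<close>

definition strong_solution ::
  "(real^2 \<Rightarrow> real) \<Rightarrow> (real^2 \<Rightarrow> complex) \<Rightarrow> (real \<Rightarrow> real) \<Rightarrow> int \<Rightarrow> real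
    \<Rightarrow> (real^2) L2 \<Rightarrow> (real \<Rightarrow> (real^2) L2) \<Rightarrow> bool" where
  "strong_solution h A chi M T u0 u \<longleftrightarrow> u \<in> C0 T \<and>
     (\<forall>t\<in>{0..<T}.
        ((\<lambda>s. propagator h (t - s) (multiplier A (cubic (P_le chi M (u s)))))
           has_integral (u t - propagator h t u0)) {0..t})"

definition solution_map ::
  "(real^2 \<Rightarrow> real) \<Rightarrow> (real^2 \<Rightarrow> complex) \<Rightarrow> (real \<Rightarrow> real) \<Rightarrow> int \<Rightarrow> real
    \<Rightarrow> (real^2) L2 \<Rightarrow> (real \<Rightarrow> (real^2) L2)" where
  "solution_map h A chi M T u0 = (THE u. strong_solution h A chi M T u0 u)"

end

theory Submission
  imports Defs "HOL-Probability.Characteristic_Functions"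
begin

text \<open>All frequencies that enter the nonlinearity lie in a fixed bounded set, so by Bernstein's
  inequality \<open>P_le chi M\<close> maps \<open>L\<^sup>2\<close> boundedly into \<open>L\<^sup>\<infinity>\<close>, and the nonlinearity is locally Lipschitz on \<open>L\<^sup>2\<close>.
  The Cauchy problem is therefore an ordinary differential equation in the interaction picture
  \<open>v(t) = exp(-i t h(D)) u(t)\<close>, which is solved by Picard iteration in a ball of radius \<open>2R\<close>; the contraction
  with factor \<open>1/2\<close> gives the Lipschitz constant \<open>2\<close> of the solution map. Solutions that may leave the ball
  are excluded by a Gronwall argument.

  The multipliers are meaningful because the Fourier transform on \<open>L\<^sup>2\<close> exists and is bijective. The bound on
  \<open>L\<^sup>1 \<inter> L\<^sup>2\<close> and the inversion formula both come from inserting a Gaussian factor on the Fourier side,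
  which turns into convolution with an approximate identity.\<close>

section \<open>The space \<open>L\<^sup>2\<close>\<close>

text \<open>The obstacle is that \<open>fourier_L2\<close>, \<open>multiplier\<close> and
  \<open>solution_map\<close> are definite descriptions: nothing is known about them before
  existence and uniqueness are proved. Hence the Fourier theory is built on explicit operators
  \<open>fourier_op c\<close> with \<open>c = 1\<close> or \<open>c = - 1\<close>, and
  \<open>fourier_L2\<close> is identified with the case \<open>c = - 1\<close> afterwards; its
  bijectivity then decides every \<open>multiplier\<close>. Completeness of \<open>L2\<close> is
  needed twice: to extend the Fourier integral by density, and to have a Banach space for the fixed
  point argument. In the interaction picture Duhamel's formula is an indefinite integral whose
  integrand does not depend on the final time, although the group is only strongly continuous. The
  Lipschitz constant of the cubic term on a ball of radius r is a multiple of r^2, so one existence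
  time of order 1/(1 + R^2) serves all data of norm at most R. A strong solution lives on a
  half-open interval, without a bound near its right end; uniqueness is therefore compared on closed
  subintervals.\<close>

lemma square_integrable_rep_L2 [simp]: "square_integrable (rep_L2 f)"
  using Quotient3_rel_rep[OF Quotient3_L2, of f f] by (simp add: L2_rel_def)

lemma abs_rep_L2 [simp]: "abs_L2 (rep_L2 f) = f"
  by (rule Quotient3_abs_rep[OF Quotient3_L2])

lemma abs_L2_eq_iff:
  assumes "square_integrable f" "square_integrable g"
  shows "abs_L2 f = abs_L2 g \<longleftrightarrow> (AE x in lebesgue. f x = g x)"
  using Quotient3_rel[OF Quotient3_L2, of f g] assms by (simp add: L2_rel_def)

lemma rep_abs_L2:
  assumes "square_integrable f"
  shows "AE x in lebesgue. rep_L2 (abs_L2 f) x = f x"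
  using assms by (subst abs_L2_eq_iff[symmetric]) auto

lemma L2_eq_iff: "f = g \<longleftrightarrow> (AE x in lebesgue. rep_L2 f x = rep_L2 g x)"
  by (subst abs_L2_eq_iff[symmetric]) auto

lemma norm_abs_L2: "square_integrable f \<Longrightarrow> norm (abs_L2 f) = L2_norm f"
  by (rule norm_L2.abs_eq) (simp add: L2_rel_def)

lemma norm_L2_rep: "norm f = L2_norm (rep_L2 f)"
  by (metis abs_rep_L2 norm_abs_L2 square_integrable_rep_L2)

lemma abs_L2_add:
  "square_integrable f \<Longrightarrow> square_integrable g \<Longrightarrow> abs_L2 f + abs_L2 g = abs_L2 (\<lambda>x. f x + g x)"
  by (rule plus_L2.abs_eq) (auto simp: L2_rel_def)

lemma abs_L2_diff:
  "square_integrable f \<Longrightarrow> square_integrable g \<Longrightarrow> abs_L2 f - abs_L2 g = abs_L2 (\<lambda>x. f x - g x)"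
  by (rule minus_L2.abs_eq) (auto simp: L2_rel_def)

lemma abs_L2_scaleR:
  "square_integrable f \<Longrightarrow> c *\<^sub>R abs_L2 f = abs_L2 (\<lambda>x. c *\<^sub>R f x)"
  by (rule scaleR_L2.abs_eq) (auto simp: L2_rel_def)

lemma rep_L2_add: "AE x in lebesgue. rep_L2 (f + g) x = rep_L2 f x + rep_L2 g x"
  using rep_abs_L2[of "\<lambda>x. rep_L2 f x + rep_L2 g x"]
  by (simp add: square_integrable_add flip: abs_L2_add)

lemma rep_L2_diff: "AE x in lebesgue. rep_L2 (f - g) x = rep_L2 f x - rep_L2 g x"
  using rep_abs_L2[of "\<lambda>x. rep_L2 f x - rep_L2 g x"]
  by (simp add: square_integrable_diff flip: abs_L2_diff)

lemma rep_L2_scaleR: "AE x in lebesgue. rep_L2 (c *\<^sub>R f) x = c *\<^sub>R rep_L2 f x"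
  using rep_abs_L2[of "\<lambda>x. c *\<^sub>R rep_L2 f x"]
  by (simp add: square_integrable_scaleR flip: abs_L2_scaleR)

section \<open>Extended-valued integrals and limit theorems in \<open>L2\<close>\<close>

lemma L2_norm_nonneg [simp]: "0 \<le> L2_norm f"
  by (simp add: L2_norm_def)

lemma L2_norm_nn_integral:
  assumes "square_integrable f"
  shows "ennreal ((L2_norm f)\<^sup>2) = (\<integral>\<^sup>+x. ennreal ((cmod (f x))\<^sup>2) \<partial>lebesgue)"
  using assms by (simp add: L2_norm_def square_integrable_def nn_integral_eq_integral)

lemma square_integrable_measurable [measurable_dest]:
  "square_integrable f \<Longrightarrow> f \<in> borel_measurable lebesgue"
  by (simp add: square_integrable_def)

lemma rep_L2_measurable [measurable]: "rep_L2 f \<in> borel_measurable lebesgue"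
  by (rule square_integrable_measurable) simp

text \<open>One bound on the extended-valued integral yields membership and the norm estimate
  together. A negative \<open>b\<close> counts as 0 under \<open>ennreal\<close>, hence the sign
  condition in the second claim.\<close>

lemma square_integrable_nn_integralI:
  assumes [measurable]: "f \<in> borel_measurable lebesgue"
    and le: "(\<integral>\<^sup>+x. ennreal ((cmod (f x))\<^sup>2) \<partial>lebesgue) \<le> ennreal b"
  shows "square_integrable f" and "b \<ge> 0 \<Longrightarrow> (L2_norm f)\<^sup>2 \<le> b"
proof -
  have "(\<integral>\<^sup>+x. ennreal ((cmod (f x))\<^sup>2) \<partial>lebesgue) < \<infinity>"
    using le by (rule order.strict_trans1) simp
  then show s: "square_integrable f"
    by (auto simp: square_integrable_def integrable_iff_bounded)
  show "(L2_norm f)\<^sup>2 \<le> b" if "b \<ge> 0"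
    using le L2_norm_nn_integral[OF s] that by (metis ennreal_le_iff)
qed

lemma square_integrable_bound:
  assumes "square_integrable g" and [measurable]: "f \<in> borel_measurable lebesgue"
    and ae: "AE x in lebesgue. cmod (f x) \<le> c * cmod (g x)" and c: "0 \<le> c"
  shows "square_integrable f" and "L2_norm f \<le> c * L2_norm g"
proof -
  have "(\<integral>\<^sup>+x. ennreal ((cmod (f x))\<^sup>2) \<partial>lebesgue)
      \<le> (\<integral>\<^sup>+x. ennreal (c\<^sup>2) * ennreal ((cmod (g x))\<^sup>2) \<partial>lebesgue)"
  proof (rule nn_integral_mono_AE)
    show "AE x in lebesgue. ennreal ((cmod (f x))\<^sup>2) \<le> ennreal (c\<^sup>2) * ennreal ((cmod (g x))\<^sup>2)"
      using ae
    proof eventually_elim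
      case (elim x)
      have "(cmod (f x))\<^sup>2 \<le> (c * cmod (g x))\<^sup>2"
        using elim by (intro power_mono) auto
      then show ?case
        by (simp add: ennreal_mult[symmetric] power_mult_distrib ennreal_leI)
    qed
  qed
  also have "\<dots> = ennreal ((c * L2_norm g)\<^sup>2)"
    using assms by (subst nn_integral_cmult)
      (auto simp: L2_norm_nn_integral[symmetric] ennreal_mult[symmetric] power_mult_distrib)
  finally have le: "(\<integral>\<^sup>+x. ennreal ((cmod (f x))\<^sup>2) \<partial>lebesgue) \<le> ennreal ((c * L2_norm g)\<^sup>2)" .
  show "square_integrable f"
    by (rule square_integrable_nn_integralI(1)[OF _ le]) simp
  have "(L2_norm f)\<^sup>2 \<le> (c * L2_norm g)\<^sup>2"
    by (rule square_integrable_nn_integralI(2)[OF _ le]) auto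
  then show "L2_norm f \<le> c * L2_norm g"
    using c by (simp add: power2_le_iff_abs_le)
qed

text \<open>Fatou's lemma for the squared moduli. It serves where norms are uniformly bounded but no
  dominating function is at hand.\<close>

lemma square_integrable_Fatou:
  assumes f: "\<And>n. square_integrable (f n)" "\<And>n. L2_norm (f n) \<le> b"
    and [measurable]: "g \<in> borel_measurable lebesgue"
    and lim: "AE x in lebesgue. (\<lambda>n. f n x) \<longlonglongrightarrow> g x"
  shows "square_integrable g" and "L2_norm g \<le> b"
proof -
  have b: "0 \<le> b"
    using order_trans[OF L2_norm_nonneg f(2)] .
  have m [measurable]: "\<And>n. f n \<in> borel_measurable lebesgue"
    using f by auto
  have "(\<integral>\<^sup>+x. ennreal ((cmod (g x))\<^sup>2) \<partial>lebesgue)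
      = (\<integral>\<^sup>+x. liminf (\<lambda>n. ennreal ((cmod (f n x))\<^sup>2)) \<partial>lebesgue)"
  proof (rule nn_integral_cong_AE)
    show "AE x in lebesgue. ennreal ((cmod (g x))\<^sup>2) = liminf (\<lambda>n. ennreal ((cmod (f n x))\<^sup>2))"
      using lim
    proof eventually_elim
      case (elim x)
      have "(\<lambda>n. ennreal ((cmod (f n x))\<^sup>2)) \<longlonglongrightarrow> ennreal ((cmod (g x))\<^sup>2)"
        by (intro tendsto_intros elim)
      then show ?case
        by (intro lim_imp_Liminf[symmetric]) auto
    qed
  qed
  also have "\<dots> \<le> liminf (\<lambda>n. (\<integral>\<^sup>+x. ennreal ((cmod (f n x))\<^sup>2) \<partial>lebesgue))"
    by (rule nn_integral_liminf) simp
  also have "\<dots> \<le> liminf (\<lambda>n::nat. ennreal (b\<^sup>2))"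
    using f b by (intro Liminf_mono always_eventually allI)
      (auto simp: L2_norm_nn_integral[symmetric] ennreal_leI power_mono)
  also have "\<dots> = ennreal (b\<^sup>2)"
    by (simp add: Liminf_const)
  finally have le: "(\<integral>\<^sup>+x. ennreal ((cmod (g x))\<^sup>2) \<partial>lebesgue) \<le> ennreal (b\<^sup>2)" .
  show "square_integrable g"
    by (rule square_integrable_nn_integralI(1)[OF _ le]) simp
  have "(L2_norm g)\<^sup>2 \<le> b\<^sup>2"
    by (rule square_integrable_nn_integralI(2)[OF _ le]) auto
  then show "L2_norm g \<le> b"
    using b by (simp add: power2_le_iff_abs_le)
qed

text \<open>Fatou's lemma for \<open>f (n + N) - rep_L2 g\<close> bounds the distance from
  \<open>h\<close> to \<open>g\<close> by every positive \<open>e\<close>, so no almost everywhere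
  convergent subsequence has to be extracted. A norm limit can thus be computed pointwise.\<close>

lemma L2_limit_AE:
  assumes lim: "X \<longlonglongrightarrow> g" and f: "\<And>n. square_integrable (f n)" "\<And>n. X n = abs_L2 (f n)"
    and [measurable]: "h \<in> borel_measurable lebesgue"
    and ae: "AE x in lebesgue. (\<lambda>n. f n x) \<longlonglongrightarrow> h x"
  shows "square_integrable h" and "abs_L2 h = g"
proof -
  let ?d = "\<lambda>x. h x - rep_L2 g x"
  have d: "square_integrable ?d \<and> L2_norm ?d \<le> e" if e: "e > 0" for e
  proof -
    obtain N where N: "\<And>n. n \<ge> N \<Longrightarrow> norm (X n - g) \<le> e"
      using LIMSEQ_D[OF lim e] by (meson less_imp_le)
    let ?f = "\<lambda>n x. f (n + N) x - rep_L2 g x"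
    have si: "square_integrable (?f n)" for n
      by (intro square_integrable_diff f) simp
    have "norm (X (n + N) - g) = L2_norm (?f n)" for n
      using abs_L2_diff[of "f (n + N)" "rep_L2 g"] f si by (simp add: norm_abs_L2)
    then have le: "L2_norm (?f n) \<le> e" for n
      using N[of "n + N"] by simp
    have "AE x in lebesgue. (\<lambda>n. ?f n x) \<longlonglongrightarrow> ?d x"
      using ae by eventually_elim (intro tendsto_intros LIMSEQ_ignore_initial_segment)
    then show ?thesis
      using square_integrable_Fatou[of ?f e ?d, OF si le] by simp
  qed
  have sd: "square_integrable ?d"
    using d[of 1] by simp
  have "L2_norm ?d \<le> 0"
    by (rule field_le_epsilon) (use d in simp)
  then have "L2_norm ?d = 0"
    by (simp add: order_antisym)
  then have "AE x in lebesgue. ?d x = 0"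
    using L2_norm_eq_0_iff[OF sd] by simp
  then have eq: "AE x in lebesgue. h x = rep_L2 g x"
    by simp
  show si: "square_integrable h"
    using square_integrable_add[OF sd, of "rep_L2 g"] by simp
  show "abs_L2 h = g"
    using eq si abs_L2_eq_iff[of h "rep_L2 g"] by simp
qed

text \<open>Scalar dominated convergence for the squared modulus of \<open>f n - g\<close>: both
  functions are bounded by |w|, so 4 |w|^2 dominates.\<close>

lemma L2_dominated_convergence:
  assumes w: "square_integrable w"
    and [measurable]: "\<And>n. f n \<in> borel_measurable lebesgue"
      "(g :: 'a::euclidean_space \<Rightarrow> complex) \<in> borel_measurable lebesgue"
    and lim: "AE x in lebesgue. (\<lambda>n. f n x) \<longlonglongrightarrow> g x"
    and dom: "\<And>n. AE x in lebesgue. cmod (f n x) \<le> cmod (w x)"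
  shows "square_integrable (f n)" and "square_integrable g" and "(\<lambda>n. abs_L2 (f n)) \<longlonglongrightarrow> abs_L2 g"
proof -
  show f: "square_integrable (f n)" for n
    using square_integrable_bound(1)[OF w, of "f n" 1] dom by simp
  have "AE x in lebesgue. \<forall>n. cmod (f n x) \<le> cmod (w x)"
    using dom by (simp add: AE_all_countable)
  then have g_le: "AE x in lebesgue. cmod (g x) \<le> cmod (w x)"
    using lim
  proof eventually_elim
    case (elim x)
    show ?case
      by (rule LIMSEQ_le_const2[OF tendsto_norm[OF elim(2)]]) (use elim(1) in auto)
  qed
  then show g: "square_integrable g"
    using square_integrable_bound(1)[OF w, of g 1] by simp
  have "(\<lambda>n. LINT x|lebesgue. (cmod (f n x - g x))\<^sup>2) \<longlonglongrightarrow> (LINT x::'a|lebesgue. 0)"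
  proof (rule integral_dominated_convergence[where w="\<lambda>x. 4 * (cmod (w x))\<^sup>2"])
    show "integrable lebesgue (\<lambda>x. 4 * (cmod (w x))\<^sup>2)"
      using w by (simp add: square_integrable_def)
    show "AE x in lebesgue. (\<lambda>n. (cmod (f n x - g x))\<^sup>2) \<longlonglongrightarrow> 0"
      using lim
    proof eventually_elim
      case (elim x)
      show ?case
        using tendsto_power[OF tendsto_norm[OF tendsto_diff[OF elim tendsto_const[of "g x"]]], of 2]
        by simp
    qed
    show "AE x in lebesgue. norm ((cmod (f n x - g x))\<^sup>2) \<le> 4 * (cmod (w x))\<^sup>2" for n
      using dom[of n] g_le
    proof eventually_elim
      case (elim x)
      have "cmod (f n x - g x) \<le> 2 * cmod (w x)"
        using norm_triangle_ineq4[of "f n x" "g x"] elim by simp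
      then have "(cmod (f n x - g x))\<^sup>2 \<le> (2 * cmod (w x))\<^sup>2"
        by (intro power_mono) auto
      then show ?case
        by (simp add: power_mult_distrib)
    qed
  qed auto
  then have "(\<lambda>n. norm (abs_L2 (f n) - abs_L2 g)) \<longlonglongrightarrow> sqrt 0"
    using f g by (simp add: abs_L2_diff norm_abs_L2 square_integrable_diff L2_norm_def)
      (use tendsto_real_sqrt in fastforce)
  then show "(\<lambda>n. abs_L2 (f n)) \<longlonglongrightarrow> abs_L2 g"
    by (simp add: LIM_zero_cancel tendsto_norm_zero_iff)
qed

section \<open>Completeness of \<open>L2\<close>\<close>

lemma L2_fast_Cauchy_convergent:
  fixes X :: "nat \<Rightarrow> 'a::euclidean_space L2"
  assumes X: "\<And>n. norm (X (Suc n) - X n) \<le> (1/2) ^ n"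
  shows "\<exists>l. X \<longlonglongrightarrow> l"
proof -
  define f where "f n = rep_L2 (X n)" for n
  have [measurable]: "f n \<in> borel_measurable lebesgue" for n
    by (simp add: f_def)
  have si: "square_integrable (f n)" for n
    by (simp add: f_def)
  have X_f: "X n = abs_L2 (f n)" for n
    by (simp add: f_def)
  have nm: "norm (X m - X n) = L2_norm (\<lambda>x. f m x - f n x)" for m n
    by (simp add: X_f abs_L2_diff si norm_abs_L2 square_integrable_diff)
  \<comment> \<open>The squared increments are summed with weight 2^n: their integrals are at most
    4^(-n), so the weighted series still has a finite integral, while its finiteness at a point
    forces geometric decay of the increments there.\<close>
  define D where "D n x = cmod (f (Suc n) x - f n x)" for n x
  have [measurable]: "D n \<in> borel_measurable lebesgue" for n
    unfolding D_def by measurable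
  have "(\<integral>\<^sup>+x. (\<Sum>n. ennreal (2 ^ n * (D n x)\<^sup>2)) \<partial>lebesgue)
      = (\<Sum>n. (\<integral>\<^sup>+x. ennreal (2 ^ n * (D n x)\<^sup>2) \<partial>lebesgue))"
    by (rule nn_integral_suminf) simp
  also have "\<dots> \<le> (\<Sum>n. ennreal ((1/2) ^ n))"
  proof (intro suminf_le allI)
    fix n
    have "(\<integral>\<^sup>+x. ennreal (2 ^ n * (D n x)\<^sup>2) \<partial>lebesgue)
        = 2 ^ n * (\<integral>\<^sup>+x. ennreal ((D n x)\<^sup>2) \<partial>lebesgue)"
      by (subst nn_integral_cmult[symmetric]) (auto simp: ennreal_mult ennreal_power[symmetric])
    also have "\<dots> = 2 ^ n * ennreal ((norm (X (Suc n) - X n))\<^sup>2)"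
      by (simp add: nm D_def L2_norm_nn_integral square_integrable_diff si)
    also have "\<dots> \<le> ennreal (2 ^ n * ((1/2) ^ n)\<^sup>2)"
    proof -
      have "2 ^ n * (norm (X (Suc n) - X n))\<^sup>2 \<le> 2 ^ n * ((1/2) ^ n)\<^sup>2"
        by (intro mult_left_mono power_mono X) auto
      then show ?thesis
        by (metis ennreal_leI ennreal_mult ennreal_numeral ennreal_power zero_le_numeral zero_le_power zero_le_power2)
    qed
    also have "2 ^ n * ((1/2) ^ n)\<^sup>2 = (1/2 :: real) ^ n"
      by (simp add: power2_eq_square power_divide)
    finally show "(\<integral>\<^sup>+x. ennreal (2 ^ n * (D n x)\<^sup>2) \<partial>lebesgue) \<le> ennreal ((1/2) ^ n)" .
  qed auto
  also have "\<dots> = ennreal (\<Sum>n. (1/2) ^ n)"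
    by (rule suminf_ennreal2) auto
  also have "\<dots> < \<infinity>"
    by simp
  finally have "AE x in lebesgue. (\<Sum>n. ennreal (2 ^ n * (D n x)\<^sup>2)) \<noteq> \<infinity>"
    by (intro nn_integral_PInf_AE) auto
  then have conv: "AE x in lebesgue. convergent (\<lambda>n. f n x)"
  proof eventually_elim
    case (elim x)
    have "summable (\<lambda>n. 2 ^ n * (D n x)\<^sup>2)"
      using elim by (intro summable_suminf_not_top) auto
    \<comment> \<open>The terms of the convergent series are bounded by some \<open>K\<close>, hence
      \<open>D n x\<close> is at most \<open>sqrt K * (sqrt (1/2)) ^ n\<close>, and the telescoping
      series converges absolutely.\<close>
    then have "Bseq (\<lambda>n. 2 ^ n * (D n x)\<^sup>2)"
      by (intro convergent_imp_Bseq) (use summable_LIMSEQ_zero in \<open>auto simp: convergent_def\<close>)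
    then obtain K where K: "K > 0" "\<And>n. 2 ^ n * (D n x)\<^sup>2 \<le> K"
      unfolding Bseq_def by (auto simp: abs_mult)
    have D_le: "D n x \<le> sqrt K * (sqrt (1/2)) ^ n" for n
    proof -
      have "(D n x)\<^sup>2 \<le> K * (1/2) ^ n"
        using K(2)[of n] by (simp add: field_simps power_divide)
      then have "sqrt ((D n x)\<^sup>2) \<le> sqrt (K * (1/2) ^ n)"
        by (rule real_sqrt_le_mono)
      then show ?thesis
        by (simp add: D_def real_sqrt_mult real_sqrt_power)
    qed
    have "summable (\<lambda>n. sqrt K * (sqrt (1/2)) ^ n)"
      by (intro summable_mult summable_geometric) (simp add: real_sqrt_lt_1_iff)
    then have "summable (\<lambda>n. f (Suc n) x - f n x)"
      by (rule summable_comparison_test[rotated]) (use D_le in \<open>auto simp: D_def\<close>)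
    then have "convergent (\<lambda>n. f n x - f 0 x)"
      using summable_iff_convergent[of "\<lambda>n. f (Suc n) x - f n x"]      by (simp add: sum_lessThan_telescope[of "\<lambda>n. f n x"])
    then have "convergent (\<lambda>n. f n x - f 0 x + f 0 x)"
      by (intro convergent_add convergent_const)
    then show ?case
      by simp
  qed
  \<comment> \<open>Where the sequence diverges \<open>lim\<close> has no specified value; these
    points form a null set.\<close>
  define g where "g x = lim (\<lambda>n. f n x)" for x
  have [measurable]: "g \<in> borel_measurable lebesgue"
    unfolding g_def by measurable
  have lim: "AE x in lebesgue. (\<lambda>n. f n x) \<longlonglongrightarrow> g x"
    using conv by eventually_elim (simp add: g_def convergent_LIMSEQ_iff)
  have tail: "norm (X (n + k) - X n) \<le> 2 * (1/2) ^ n" for n k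
  proof -
    \<comment> \<open>The subtracted term is the remainder of the geometric series; with it the
      induction on \<open>k\<close> closes.\<close>
    have "norm (X (n + k) - X n) \<le> 2 * (1/2) ^ n - 2 * (1/2) ^ (n + k)"
    proof (induction k)
      case (Suc k)
      have "norm (X (n + Suc k) - X n) \<le> norm (X (Suc (n + k)) - X (n + k)) + norm (X (n + k) - X n)"
        using norm_triangle_ineq[of "X (Suc (n + k)) - X (n + k)" "X (n + k) - X n"] by simp
      also have "\<dots> \<le> (1/2) ^ (n + k) + (2 * (1/2) ^ n - 2 * (1/2) ^ (n + k))"
        by (intro add_mono X Suc)
      finally show ?case
        by simp
    qed simp
    then show ?thesis
      by (smt (verit) zero_le_power divide_nonneg_nonneg)
  qed
  have diff: "square_integrable (\<lambda>x. g x - f n x) \<and> L2_norm (\<lambda>x. g x - f n x) \<le> 2 * (1/2) ^ n" for n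
  proof -
    have "AE x in lebesgue. (\<lambda>k. f (n + k) x - f n x) \<longlonglongrightarrow> g x - f n x"
      using lim by eventually_elim
        (intro tendsto_intros LIMSEQ_ignore_initial_segment[of _ _ n, simplified add.commute[of _ n]])
    then show ?thesis
      using square_integrable_Fatou[of "\<lambda>k x. f (n + k) x - f n x" "2 * (1/2) ^ n" "\<lambda>x. g x - f n x"]
      by (simp add: square_integrable_diff si tail flip: nm)
  qed
  then have g: "square_integrable g"
    using square_integrable_add[of "\<lambda>x. g x - f 0 x" "f 0"] si by simp
  have "norm (X n - abs_L2 g) \<le> 2 * (1/2) ^ n" for n
    using diff[of n] by (subst norm_minus_commute) (simp add: X_f abs_L2_diff g si norm_abs_L2)
  then have "\<forall>\<^sub>F n in sequentially. norm (X n - abs_L2 g) \<le> 2 * (1/2) ^ n"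
    by simp
  moreover have "(\<lambda>n. 2 * (1/2 :: real) ^ n) \<longlonglongrightarrow> 0"
    using tendsto_mult_right_zero[OF LIMSEQ_realpow_zero[of "1/2 :: real"]] by simp
  ultimately have "(\<lambda>n. X n - abs_L2 g) \<longlonglongrightarrow> 0"
    by (rule Lim_null_comparison)
  then show ?thesis
    using LIM_zero_cancel by blast
qed

instance L2 :: (euclidean_space) banach
proof
  fix X :: "nat \<Rightarrow> 'a L2"
  assume "Cauchy X"
  then have "\<exists>N. \<forall>m\<ge>N. \<forall>n\<ge>N. norm (X m - X n) < (1/2) ^ k" for k
    by (intro CauchyD) auto
  then obtain N where N: "\<And>k m n. m \<ge> N k \<Longrightarrow> n \<ge> N k \<Longrightarrow> norm (X m - X n) < (1/2) ^ k"
    by metis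
  \<comment> \<open>The sum dominates \<open>N n\<close>, and the added \<open>n\<close> makes
    \<open>r\<close> strictly increasing.\<close>
  define r where "r n = (\<Sum>k\<le>n. N k) + n" for n
  have r_N: "N n \<le> r n" for n
    unfolding r_def by (simp add: member_le_sum trans_le_add1)
  have r: "strict_mono r"
    by (auto simp: strict_mono_Suc_iff r_def)
  have "norm ((X \<circ> r) (Suc n) - (X \<circ> r) n) \<le> (1/2) ^ n" for n
    using N[of n "r (Suc n)" "r n"] r_N[of n] strict_monoD[OF r, of n "Suc n"] by simp
  then obtain l where "(X \<circ> r) \<longlonglongrightarrow> l"
    using L2_fast_Cauchy_convergent by blast
  then have "X \<longlonglongrightarrow> l"
    by (rule Cauchy_converges_subseq[OF \<open>Cauchy X\<close> r])
  then show "convergent X"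
    by (auto simp: convergent_def)
qed

section \<open>Dense subsets of \<open>L2\<close>\<close>

lemma L2_truncation_dense:
  fixes f :: "'a::euclidean_space \<Rightarrow> complex"
  assumes f: "square_integrable f"
  defines "c \<equiv> \<lambda>n x. indicator (ball 0 (real n)) x *\<^sub>R f x"
  shows "square_integrable (c n)" "integrable lebesgue (c n)" "(\<lambda>n. abs_L2 (c n)) \<longlonglongrightarrow> abs_L2 f"
proof -
  have [measurable]: "f \<in> borel_measurable lebesgue"
    using f by auto
  have [measurable]: "ball 0 r \<in> sets lebesgue" for r
    by auto
  have [measurable]: "c n \<in> borel_measurable lebesgue" for n
    unfolding c_def by (intro borel_measurable_scaleR borel_measurable_indicator) auto
  have le: "cmod (c n x) \<le> cmod (f x)" for n x
    by (auto simp: c_def indicator_def)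
  have lim: "(\<lambda>n. c n x) \<longlonglongrightarrow> f x" for x
  proof (rule tendsto_eventually)
    obtain N :: nat where "norm x < N"
      using reals_Archimedean2 by blast
    then show "\<forall>\<^sub>F n in sequentially. c n x = f x"
      by (intro eventually_sequentiallyI[of N]) (auto simp: c_def indicator_def)
  qed
  show si: "square_integrable (c n)"
    by (rule L2_dominated_convergence(1)[OF f, of c f]) (simp_all add: lim le)
  show "(\<lambda>n. abs_L2 (c n)) \<longlonglongrightarrow> abs_L2 f"
    by (rule L2_dominated_convergence(3)[OF f, of c f]) (simp_all add: lim le)
  show "integrable lebesgue (c n)"
  proof (rule Bochner_Integration.integrable_bound)
    have "emeasure lebesgue (ball 0 (real n) :: 'a set) < \<infinity>"
      using emeasure_lborel_ball_finite by simp
    then show "integrable lebesgue (\<lambda>x. indicator (ball 0 (real n)) x + (cmod (c n x))\<^sup>2 :: real)"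
      using si by (auto simp: square_integrable_def)
    show "AE x in lebesgue. cmod (c n x) \<le> norm (indicator (ball 0 (real n)) x + (cmod (c n x))\<^sup>2 :: real)"
    proof (rule AE_I2)
      fix x
      have "2 * cmod (c n x) \<le> 1 + (cmod (c n x))\<^sup>2"
        using sum_squares_bound[of 1 "cmod (c n x)"] by simp
      then have "cmod (c n x) \<le> 1 + (cmod (c n x))\<^sup>2"
        using norm_ge_zero[of "c n x"] by linarith
      then show "cmod (c n x) \<le> norm (indicator (ball 0 (real n)) x + (cmod (c n x))\<^sup>2 :: real)"
        by (auto simp: c_def indicator_def)
    qed
  qed simp
qed

text \<open>Density in the form of an induction rule: Urysohn functions approximate indicators,
  simple functions are finite sums of scaled indicators, and dominated convergence reaches every
  class. Closure under addition suffices because the indicators carry the scalars. The continuity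
  and boundedness offered for \<open>g\<close> are what the approximate identity works with.\<close>

lemma L2_dense_continuous:
  fixes S :: "'a::euclidean_space L2 set"
  assumes S: "closed S"
    and add: "\<And>f g. f \<in> S \<Longrightarrow> g \<in> S \<Longrightarrow> f + g \<in> S"
    and cont: "\<And>g. continuous_on UNIV g \<Longrightarrow> bounded (range g) \<Longrightarrow> integrable lebesgue g
      \<Longrightarrow> square_integrable g \<Longrightarrow> abs_L2 g \<in> S"
  shows "f \<in> S"
proof -
  have ind: "square_integrable (\<lambda>x. c * indicator B x) \<and> abs_L2 (\<lambda>x. c * indicator B x) \<in> S"
    if B: "B \<in> sets lebesgue" "emeasure lebesgue B < \<infinity>" for B c
  proof -
    have [measurable]: "B \<in> sets lebesgue"
      by fact
    have si_ind: "square_integrable (\<lambda>x. c * indicator A x)"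
      and norm_ind: "(L2_norm (\<lambda>x. c * indicator A x))\<^sup>2 = (cmod c)\<^sup>2 * measure lebesgue A"
      if A: "A \<in> sets lebesgue" "emeasure lebesgue A < \<infinity>" for A :: "'a set" and c
    proof -
      have [measurable]: "A \<in> sets lebesgue"
        by fact
      have eq: "(cmod (c * indicator A x))\<^sup>2 = (cmod c)\<^sup>2 * indicator A x" for x
        by (auto simp: indicator_def)
      show "square_integrable (\<lambda>x. c * indicator A x)"
        unfolding square_integrable_def eq using A by auto
      show "(L2_norm (\<lambda>x. c * indicator A x))\<^sup>2 = (cmod c)\<^sup>2 * measure lebesgue A"
        unfolding L2_norm_def eq by simp
    qed
    have "abs_L2 (\<lambda>x. c * indicator B x) \<in> closure S"
      unfolding closure_approachable
    proof (intro allI impI)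
      fix e :: real
      assume "e > 0"
      \<comment> \<open>Chosen so that |c|^2 times \<open>2 * d\<close>, the bound for the measure
        of \<open>U - K\<close>, stays below e^2; the summand 1 covers \<open>c = 0\<close>.\<close>
      define d where "d = e\<^sup>2 / (2 * ((cmod c)\<^sup>2 + 1))"
      have "d > 0"
        using \<open>e > 0\<close> by (auto simp: d_def intro!: divide_pos_pos add_nonneg_pos)
      obtain U where U: "open U" "B \<subseteq> U" "U - B \<in> lmeasurable" "emeasure lebesgue (U - B) < ennreal d"
        using sets_lebesgue_outer_open[OF B(1) \<open>d > 0\<close>] .
      obtain K where K: "closed K" "K \<subseteq> B" "B - K \<in> lmeasurable" "emeasure lebesgue (B - K) < ennreal d"
        using sets_lebesgue_inner_closed[OF B(1) \<open>d > 0\<close>] .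
      have [measurable]: "U \<in> sets lebesgue" "K \<in> sets lebesgue"
        using U K by auto
      have UK: "U - K \<in> sets lebesgue" "emeasure lebesgue (U - K) < ennreal (2 * d)"
      proof -
        have "U - K = (U - B) \<union> (B - K)"
          using U K by auto
        then have "emeasure lebesgue (U - K) \<le> emeasure lebesgue (U - B) + emeasure lebesgue (B - K)"
          using emeasure_subadditive[of "U - B" lebesgue "B - K"] by simp
        also have "\<dots> < ennreal d + ennreal d"
          using U K by (intro add_strict_mono)
        finally show "emeasure lebesgue (U - K) < ennreal (2 * d)"
          using \<open>d > 0\<close> by (simp add: ennreal_plus[symmetric])
      qed simp
      have fU: "emeasure lebesgue U < \<infinity>"
      proof -
        have "emeasure lebesgue U \<le> emeasure lebesgue (U - B) + emeasure lebesgue B"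
          using emeasure_subadditive[of "U - B" lebesgue B] U(2) by (simp add: Un_absorb2)
        also have "\<dots> < \<infinity>"
          using U(3) B(2) by (simp add: fmeasurable_def)
        finally show ?thesis .
      qed
      obtain g :: "'a \<Rightarrow> real" where g: "continuous_on UNIV g" "\<And>x. g x \<in> closed_segment 0 1"
          "\<And>x. x \<in> - U \<Longrightarrow> g x = 0" "\<And>x. x \<in> K \<Longrightarrow> g x = 1"
        using Urysohn[of "- U" K 0 "1::real"] U K by blast
      then have g01: "0 \<le> g x" "g x \<le> 1" for x
        using g(2)[of x] by (auto simp: closed_segment_eq_real_ivl)
      have [measurable]: "g \<in> borel_measurable lebesgue"
        using measurable_completion[of g lborel borel] borel_measurable_continuous_onI[OF g(1)] by simp
      define G where "G x = c * of_real (g x)" for x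
      have G_le: "cmod (G x) \<le> cmod (c * indicator U x)" for x
        using g01[of x] g(3)[of x] by (auto simp: G_def norm_mult indicator_def mult_left_le)
      \<comment> \<open>The two functions agree on \<open>K\<close> and off \<open>U\<close>; in
        between both are multiples of \<open>c\<close> by a factor in [0,1].\<close>
      have G_diff: "cmod (G x - c * indicator B x) \<le> 1 * cmod (c * indicator (U - K) x)" for x
      proof -
        consider "x \<in> K" | "x \<in> U - K" | "x \<notin> U"
          by auto
        then show ?thesis
        proof cases
          case 2
          have "cmod (G x - c * indicator B x) = cmod c * cmod (of_real (g x - indicator B x))"
            by (simp add: G_def indicator_def algebra_simps flip: norm_mult)
          also have "\<dots> \<le> cmod c * 1"
            unfolding norm_of_real using g01[of x] by (intro mult_left_mono) (auto simp: indicator_def)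
          finally show ?thesis
            using 2 by simp
        qed (use U K g in \<open>auto simp: G_def indicator_def\<close>)
      qed
      have m [measurable]: "G \<in> borel_measurable lebesgue"
        unfolding G_def by measurable
      have G: "square_integrable G"
        using square_integrable_bound(1)[OF si_ind[of U c], of G 1] fU G_le by simp
      have "abs_L2 G \<in> S"
      proof (rule cont)
        show "continuous_on UNIV G"
          unfolding G_def by (intro continuous_intros g)
        have "cmod (G x) \<le> cmod c" for x
          using G_le[of x] by (cases "x \<in> U") auto
        then show "bounded (range G)"
          by (auto simp: bounded_iff)
        have "integrable lebesgue (\<lambda>x. c * of_real (indicator U x))"
          by (intro integrable_mult_right integrable_of_real integrable_real_indicator fU) auto
        then show "integrable lebesgue G"
        proof (rule Bochner_Integration.integrable_bound)
          show "AE x in lebesgue. cmod (G x) \<le> cmod (c * of_real (indicator U x))"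
          proof (rule AE_I2)
            show "cmod (G x) \<le> cmod (c * of_real (indicator U x))" for x
              using G_le[of x] by (cases "x \<in> U") auto
          qed
        qed (rule m)
      qed (rule G)
      moreover have "dist (abs_L2 G) (abs_L2 (\<lambda>x. c * indicator B x)) < e"
      proof -
        have "dist (abs_L2 G) (abs_L2 (\<lambda>x. c * indicator B x)) = L2_norm (\<lambda>x. G x - c * indicator B x)"
          using si_ind[OF B] G by (simp add: dist_norm abs_L2_diff norm_abs_L2 square_integrable_diff)
        also have "\<dots> \<le> 1 * L2_norm (\<lambda>x. c * indicator (U - K) x)"
        proof (rule square_integrable_bound(2))
          show "square_integrable (\<lambda>x. c * indicator (U - K) x)"
            using UK by (intro si_ind) (auto intro: less_trans)
          show "AE x in lebesgue. cmod (G x - c * indicator B x) \<le> 1 * cmod (c * indicator (U - K) x)"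
            using G_diff by simp
        qed auto
        also have "\<dots> < e"
        proof -
          have f: "emeasure lebesgue (U - K) < \<infinity>"
            using UK(2) by (rule less_trans) simp
          have "ennreal (measure lebesgue (U - K)) < ennreal (2 * d)"
            using UK(2) f emeasure_eq_ennreal_measure[of lebesgue "U - K"] by (metis infinity_ennreal_def less_irrefl)
          then have "measure lebesgue (U - K) \<le> 2 * d"
            by (metis ennreal_less_iff less_imp_le measure_nonneg)
          then have "(L2_norm (\<lambda>x. c * indicator (U - K) x))\<^sup>2 \<le> (cmod c)\<^sup>2 * (2 * d)"
            unfolding norm_ind[OF UK(1) f] by (intro mult_left_mono) auto
          also have "\<dots> < ((cmod c)\<^sup>2 + 1) * (2 * d)"
            using \<open>d > 0\<close> by simp
          also have "\<dots> = e\<^sup>2"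
            unfolding d_def by (simp add: field_simps add_nonneg_eq_0_iff)
          finally show ?thesis
            using \<open>e > 0\<close> by (simp add: power2_less_imp_less)
        qed
        finally show ?thesis .
      qed
      ultimately show "\<exists>y\<in>S. dist y (abs_L2 (\<lambda>x. c * indicator B x)) < e"
        by blast
    qed
    then show ?thesis
      using S B by (simp add: closure_closed si_ind)
  qed
  have zero: "abs_L2 (\<lambda>x. 0) \<in> S"
    using ind[of "{}" 0] by simp
  obtain s where s: "\<And>i. simple_function lebesgue (s i)" "\<And>x. (\<lambda>i. s i x) \<longlonglongrightarrow> rep_L2 f x"
      "\<And>i x. cmod (s i x) \<le> 2 * cmod (rep_L2 f x)"
    using borel_measurable_implies_sequence_metric[OF rep_L2_measurable, of f 0] by (auto simp: dist_norm)
  have [measurable]: "s i \<in> borel_measurable lebesgue" for i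
    using s(1) by (rule borel_measurable_simple_function)
  have si_2: "square_integrable (\<lambda>x. 2 * rep_L2 f x)"
    by (intro square_integrable_scale) simp
  have dom: "AE x in lebesgue. cmod (s i x) \<le> cmod (2 * rep_L2 f x)" for i
    using s(3) by (simp add: norm_mult)
  have si_s: "square_integrable (s i)" for i
    by (rule L2_dominated_convergence(1)[OF si_2, of s "rep_L2 f"]) (use s dom in auto)
  have "abs_L2 (s i) \<in> S" for i
  proof -
    let ?L = "\<lambda>y. s i -` {y}"
    \<comment> \<open>Chebyshev's inequality bounds the level set of a nonzero value; the zero level
      may have infinite measure and is left out of the sum below.\<close>
    have fin: "?L y \<in> sets lebesgue \<and> emeasure lebesgue (?L y) < \<infinity>" if "y \<noteq> 0" for y
    proof -
      have L: "?L y \<in> sets lebesgue"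
        using measurable_sets[of "s i" lebesgue borel "{y}"] by simp
      have "integrable lebesgue (indicator (?L y) :: 'a \<Rightarrow> real)"
      proof (rule Bochner_Integration.integrable_bound)
        show "integrable lebesgue (\<lambda>x. (cmod (s i x))\<^sup>2 / (cmod y)\<^sup>2)"
          using si_s by (simp add: square_integrable_def)
        show "AE x in lebesgue. norm (indicator (?L y) x :: real) \<le> norm ((cmod (s i x))\<^sup>2 / (cmod y)\<^sup>2)"
          using that by (auto simp: indicator_def)
      qed (use L in simp)
      then show ?thesis
        using L by (simp add: integrable_indicator_iff)
    qed
    define t where "t y x = y * indicator (?L y) x" for y x
    have sum_in: "square_integrable (\<lambda>x. \<Sum>y\<in>F. t y x) \<and> abs_L2 (\<lambda>x. \<Sum>y\<in>F. t y x) \<in> S"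
      if "finite F" "0 \<notin> F" for F
      using that
    proof (induction F)
      case empty
      then show ?case
        by (simp add: zero square_integrable_zero)
    next
      case (insert y F)
      have y: "square_integrable (t y) \<and> abs_L2 (t y) \<in> S"
        unfolding t_def using insert.prems fin by (intro ind) (metis insertI1)+
      then show ?case
        using insert add[of "abs_L2 (t y)" "abs_L2 (\<lambda>x. \<Sum>y\<in>F. t y x)"]
        by (simp add: square_integrable_add abs_L2_add)
    qed
    have fr: "finite (range (s i))"
      using s(1)[of i] by (simp add: simple_function_def)
    have "s i = (\<lambda>x. \<Sum>y\<in>range (s i) - {0}. t y x)"
    proof
      fix x
      have "(\<Sum>y\<in>range (s i) - {0}. t y x) = (\<Sum>y\<in>range (s i). t y x)"
        by (rule sum.mono_neutral_left) (use fr in \<open>auto simp: t_def\<close>)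
      also have "\<dots> = (\<Sum>y\<in>range (s i). if y = s i x then y else 0)"
        by (intro sum.cong) (auto simp: t_def indicator_def)
      also have "\<dots> = s i x"
        using fr by simp
      finally show "s i x = (\<Sum>y\<in>range (s i) - {0}. t y x)"
        by simp
    qed
    then show ?thesis
      using sum_in[of "range (s i) - {0}"] fr by simp
  qed
  moreover have "(\<lambda>i. abs_L2 (s i)) \<longlonglongrightarrow> abs_L2 (rep_L2 f)"
    by (rule L2_dominated_convergence(3)[OF si_2]) (use s dom in auto)
  ultimately show ?thesis
    using S closed_sequentially[of S "\<lambda>i. abs_L2 (s i)"] by simp
qed

section \<open>Gaussians\<close>

lemma borel_measurable_cis [measurable (raw)]:
  "f \<in> borel_measurable M \<Longrightarrow> (\<lambda>x. cis (f x)) \<in> borel_measurable M"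
  by (rule borel_measurable_continuous_on[OF continuous_on_cis[OF continuous_on_id]])

section \<open>Affine substitution and product integrals for Lebesgue measure\<close>

lemma integrable_lebesgue_lborel:
  fixes f :: "'a::euclidean_space \<Rightarrow> 'b::{banach,second_countable_topology}"
  assumes "f \<in> borel_measurable borel"
  shows "integrable lebesgue f \<longleftrightarrow> integrable lborel f"
  using assms by (intro integrable_completion) simp

lemma integral_lborel_affine:
  fixes f :: "'a::euclidean_space \<Rightarrow> 'b::{banach,second_countable_topology}"
  assumes [measurable]: "f \<in> borel_measurable borel" and "c \<noteq> 0"
  shows "(LINT x|lborel. f x) = \<bar>c\<bar> ^ DIM('a) *\<^sub>R (LINT x|lborel. f (t + c *\<^sub>R x))"
  using assms(2)
  by (subst lborel_affine[OF assms(2), of t])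
    (simp add: integral_density integral_distr)

lemma nn_integral_lborel_affine:
  fixes f :: "'a::euclidean_space \<Rightarrow> ennreal"
  assumes [measurable]: "f \<in> borel_measurable borel" and "c \<noteq> 0"
  shows "(\<integral>\<^sup>+x. f x \<partial>lborel) = ennreal (\<bar>c\<bar> ^ DIM('a)) * (\<integral>\<^sup>+x. f (t + c *\<^sub>R x) \<partial>lborel)"
  using assms(2)
  by (subst lborel_affine[OF assms(2), of t])
    (simp add: nn_integral_density nn_integral_distr nn_integral_cmult)

text \<open>\<open>lborel\<close> is the image of a product of real Lebesgue measures under the
  coordinate map, so integrals of tensor products factor.\<close>

lemma integral_lborel_prod:
  fixes f :: "'a::euclidean_space \<Rightarrow> real \<Rightarrow> 'b::{real_normed_field,banach,second_countable_topology}"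
  assumes f: "\<And>b. b \<in> Basis \<Longrightarrow> integrable lborel (f b)"
  shows "integrable lborel (\<lambda>x::'a. \<Prod>b\<in>Basis. f b (x \<bullet> b))"
    and "(LINT x::'a|lborel. (\<Prod>b\<in>Basis. f b (x \<bullet> b))) = (\<Prod>b\<in>Basis. LINT x|lborel. f b x)"
proof -
  interpret product_sigma_finite "\<lambda>_::'a. lborel :: real measure"
    by standard
  have [measurable]: "b \<in> Basis \<Longrightarrow> f b \<in> borel_measurable borel" for b
    using borel_measurable_integrable[OF f] by simp
  have eq: "(\<Prod>b\<in>Basis. f b ((\<Sum>i\<in>Basis. x i *\<^sub>R i) \<bullet> b)) = (\<Prod>b\<in>Basis. f b (x b))" for x :: "'a \<Rightarrow> real"
    by (intro prod.cong refl arg_cong2[where f=f]) (simp add: inner_sum_left inner_Basis if_distrib cong: if_cong)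
  have m: "(\<lambda>x. \<Prod>b\<in>Basis. f b (x \<bullet> b)) \<in> borel_measurable (borel :: 'a measure)"
    by (intro borel_measurable_prod) measurable
  have T: "(\<lambda>x. \<Sum>b\<in>Basis. x b *\<^sub>R b) \<in> (\<Pi>\<^sub>M b\<in>Basis. lborel) \<rightarrow>\<^sub>M (borel :: 'a measure)"
    by measurable
  show "integrable lborel (\<lambda>x::'a. \<Prod>b\<in>Basis. f b (x \<bullet> b))"
    unfolding lborel_eq[where 'a='a]
    by (subst integrable_distr_eq[OF T m]) (simp add: eq product_integrable_prod f)
  show "(LINT x::'a|lborel. (\<Prod>b\<in>Basis. f b (x \<bullet> b))) = (\<Prod>b\<in>Basis. LINT x|lborel. f b x)"
    unfolding lborel_eq[where 'a='a]
    by (subst integral_distr[OF T m]) (simp add: eq product_integral_prod f flip: lborel_eq_real)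
qed

text \<open>\<open>s\<close> scales the variable: a small \<open>s\<close> means a wide Gaussian,
  \<open>gauss 0\<close> is the constant 1, and letting \<open>s\<close> tend to 0 removes the
  cut-off.\<close>

definition gauss :: "real \<Rightarrow> 'a::euclidean_space \<Rightarrow> real" where
  "gauss s x = exp (- (s * norm x)\<^sup>2 / 2)"

lemma gauss_measurable [measurable]: "gauss s \<in> borel_measurable borel"
  unfolding gauss_def by measurable

lemma gauss_nonneg [simp]: "0 \<le> gauss s x"
  by (simp add: gauss_def)

lemma gauss_le_1 [simp]: "gauss s x \<le> 1"
  by (simp add: gauss_def)

lemma gauss_uminus [simp]: "gauss s (- x) = gauss s x"
  by (simp add: gauss_def)

lemma gauss_scaleR: "gauss s x = gauss 1 (s *\<^sub>R x)"
  by (simp add: gauss_def power_mult_distrib)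

text \<open>This is the characteristic function of the standard normal distribution, freed from its
  normalisation \<open>sqrt (2 * pi)\<close>.\<close>

lemma fourier_gauss_real:
  "integrable lborel (\<lambda>x::real. cis (t * x) * of_real (exp (- x\<^sup>2 / 2)))"
  "(LINT x::real|lborel. cis (t * x) * of_real (exp (- x\<^sup>2 / 2))) = of_real (sqrt (2 * pi) * exp (- t\<^sup>2 / 2))"
proof -
  have eq: "cis (t * x) * of_real (exp (- x\<^sup>2 / 2)) = sqrt (2 * pi) * (std_normal_density x *\<^sub>R iexp (t * x))" for x
    by (simp add: std_normal_density_def scaleR_conv_of_real cis_conv_exp field_simps)
  have "integrable lborel (\<lambda>x. std_normal_density x *\<^sub>R iexp (t * x))"
    by (rule Bochner_Integration.integrable_bound[of lborel std_normal_density])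
      (auto simp: integrable_normal_density)
  then show "integrable lborel (\<lambda>x::real. cis (t * x) * of_real (exp (- x\<^sup>2 / 2)))"
    unfolding eq by (intro integrable_mult_right)
  have "(LINT x|lborel. std_normal_density x *\<^sub>R iexp (t * x)) = char std_normal_distribution t"
    unfolding char_def by (subst integral_density) auto
  then show "(LINT x::real|lborel. cis (t * x) * of_real (exp (- x\<^sup>2 / 2))) = of_real (sqrt (2 * pi) * exp (- t\<^sup>2 / 2))"
    unfolding eq integral_mult_right_zero by (simp add: char_std_normal_distribution)
qed

text \<open>The Gaussian and the character both factor over the coordinates, which reduces
  everything to the real line.\<close>

lemma fourier_gauss_1:
  fixes \<xi> :: "'a::euclidean_space"
  shows "integrable lborel (\<lambda>x. cis (x \<bullet> \<xi>) * of_real (gauss 1 x))"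
    and "(LINT x|lborel. cis (x \<bullet> \<xi>) * of_real (gauss 1 x)) = of_real (sqrt (2 * pi) ^ DIM('a) * gauss 1 \<xi>)"
proof -
  have g: "gauss 1 x = (\<Prod>b\<in>Basis. exp (- (x \<bullet> b)\<^sup>2 / 2))" for x :: 'a
    unfolding gauss_def
    by (simp add: exp_sum[symmetric] norm_eq_sqrt_inner euclidean_inner[of x x] power2_eq_square
        sum_nonneg sum_divide_distrib[symmetric] sum_negf)
  have c: "cis (x \<bullet> \<xi>) = (\<Prod>b\<in>Basis. cis ((\<xi> \<bullet> b) * (x \<bullet> b)))" for x
    by (simp add: cis_conv_exp exp_sum[symmetric] euclidean_inner[of x \<xi>] sum_distrib_left mult_ac)
  have eq: "cis (x \<bullet> \<xi>) * of_real (gauss 1 x)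
      = (\<Prod>b\<in>Basis. cis ((\<xi> \<bullet> b) * (x \<bullet> b)) * of_real (exp (- (x \<bullet> b)\<^sup>2 / 2)))" for x
    unfolding g c by (simp add: prod.distrib)
  show "integrable lborel (\<lambda>x. cis (x \<bullet> \<xi>) * of_real (gauss 1 x))"
    unfolding eq by (rule integral_lborel_prod(1)[OF fourier_gauss_real(1)])
  show "(LINT x|lborel. cis (x \<bullet> \<xi>) * of_real (gauss 1 x)) = of_real (sqrt (2 * pi) ^ DIM('a) * gauss 1 \<xi>)"
    unfolding eq
    by (subst integral_lborel_prod(2)[OF fourier_gauss_real(1)])
      (simp only: fourier_gauss_real(2) g, simp add: prod.distrib)
qed

lemma integrable_gauss:
  assumes "s \<noteq> 0"
  shows "integrable lebesgue (\<lambda>x::'a::euclidean_space. gauss s (t + x))"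
proof -
  have "integrable lborel (\<lambda>x::'a. of_real (gauss 1 x) :: complex)"
    using fourier_gauss_1(1)[of "0::'a"] by simp
  then have 1: "integrable lborel (\<lambda>x::'a. gauss 1 x)"
    using complex_of_real_integrable_eq by blast
  have "(\<integral>\<^sup>+(x::'a). gauss 1 x \<partial>lborel) < \<infinity>"
    using 1 by (simp add: integrable_iff_bounded)
  then have "(\<integral>\<^sup>+(x::'a). gauss 1 (s *\<^sub>R t + s *\<^sub>R x) \<partial>lborel) < \<infinity>"
    using assms by (subst (asm) nn_integral_lborel_affine[of _ s "s *\<^sub>R t"])
      (auto simp: ennreal_mult_less_top)
  then have "integrable lborel (\<lambda>x::'a. gauss s (t + x))"
    by (simp add: integrable_iff_bounded gauss_scaleR[of s] scaleR_add_right)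
  then show ?thesis
    by (subst integrable_lebesgue_lborel) auto
qed

text \<open>\<open>gauss_kernel s\<close> is the approximate identity obtained as the inverse Fourier transform of \<open>gauss s\<close>.\<close>

definition gauss_kernel :: "real \<Rightarrow> 'a::euclidean_space \<Rightarrow> real" where
  "gauss_kernel s x = gauss (1 / s) x / (s * sqrt (2 * pi)) ^ DIM('a)"

lemma gauss_kernel_measurable [measurable]: "gauss_kernel s \<in> borel_measurable borel"
  unfolding gauss_kernel_def by measurable

lemma gauss_kernel_nonneg [simp]: "s > 0 \<Longrightarrow> 0 \<le> gauss_kernel s x"
  by (simp add: gauss_kernel_def)

lemma gauss_kernel_commute: "gauss_kernel s (x - y) = gauss_kernel s (y - x)"
  unfolding gauss_kernel_def by (metis gauss_uminus minus_diff_eq)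

text \<open>Scaling reduces to width 1. Of the two factors \<open>sqrt (2 * pi) ^ DIM('a)\<close> in
  the constant, one comes from the transform and the other cancels the normalisation of
  \<open>gauss_kernel\<close>.\<close>

lemma fourier_gauss:
  fixes \<xi> :: "'a::euclidean_space"
  assumes s: "s > 0"
  shows "(LINT x|lebesgue. cis (x \<bullet> \<xi>) * of_real (gauss s x)) = of_real ((2 * pi) ^ DIM('a) * gauss_kernel s \<xi>)"
proof -
  have "(LINT x|lebesgue. cis (x \<bullet> \<xi>) * of_real (gauss s x)) = (LINT x|lborel. cis (x \<bullet> \<xi>) * of_real (gauss s x))"
    by (rule integral_completion) measurable
  also have "\<dots> = (1 / s) ^ DIM('a) *\<^sub>R (LINT x|lborel. cis (x \<bullet> ((1 / s) *\<^sub>R \<xi>)) * of_real (gauss 1 x))"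
    using s by (subst integral_lborel_affine[where c="1 / s" and t=0])
      (auto simp: gauss_scaleR[of s])
  also have "\<dots> = of_real ((2 * pi) ^ DIM('a) * gauss_kernel s \<xi>)"
  proof -
    have "(2 * pi) ^ DIM('a) = sqrt (2 * pi) ^ DIM('a) * sqrt (2 * pi) ^ DIM('a)"
      by (subst power_mult_distrib[of "sqrt (2 * pi)" "sqrt (2 * pi)", symmetric]) simp
    moreover have "gauss 1 ((1 / s) *\<^sub>R \<xi>) = gauss (1 / s) \<xi>"
      by (rule gauss_scaleR[symmetric])
    ultimately show ?thesis
      unfolding fourier_gauss_1(2) using s
      by (simp add: gauss_kernel_def scaleR_conv_of_real power_mult_distrib field_simps)
  qed
  finally show ?thesis .
qed

text \<open>The total mass is read off from the Gaussian transform at frequency 0; the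
  extended-valued form fits Tonelli's theorem.\<close>

lemma nn_integral_gauss_kernel:
  assumes s: "s > 0"
  shows "(\<integral>\<^sup>+x. ennreal (gauss_kernel s (x - y :: 'a::euclidean_space)) \<partial>lebesgue) = 1"
proof -
  have "(\<integral>\<^sup>+x. ennreal (gauss_kernel s (x - y)) \<partial>lebesgue) = (\<integral>\<^sup>+x. ennreal (gauss_kernel s (x - y)) \<partial>lborel)"
    by (rule nn_integral_completion)
  also have "\<dots> = ennreal (s ^ DIM('a)) * (\<integral>\<^sup>+x. ennreal (gauss_kernel s (s *\<^sub>R x :: 'a)) \<partial>lborel)"
    using s by (subst nn_integral_lborel_affine[of _ s y]) auto
  also have "\<dots> = (\<integral>\<^sup>+x. ennreal (s ^ DIM('a) * gauss_kernel s (s *\<^sub>R x :: 'a)) \<partial>lborel)"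
    using s by (subst nn_integral_cmult[symmetric]) (auto simp: ennreal_mult)
  also have "\<dots> = (\<integral>\<^sup>+x. ennreal (gauss 1 (x :: 'a) / sqrt (2 * pi) ^ DIM('a)) \<partial>lborel)"
    using s by (intro nn_integral_cong arg_cong[where f=ennreal])
      (simp add: gauss_kernel_def gauss_scaleR[of "1 / s"] power_mult_distrib)
  also have "\<dots> = ennreal (LINT x|lborel. gauss 1 (x :: 'a) / sqrt (2 * pi) ^ DIM('a))"
    using integrable_gauss[of 1 "0 :: 'a"]
    by (intro nn_integral_eq_integral) (auto simp: integrable_lebesgue_lborel)
  also have "(LINT x|lborel. gauss 1 (x :: 'a) / sqrt (2 * pi) ^ DIM('a)) = 1"
  proof -
    have "of_real (LINT x|lborel. gauss 1 (x :: 'a)) = (of_real (sqrt (2 * pi) ^ DIM('a)) :: complex)"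
      using fourier_gauss_1(2)[of "0 :: 'a"] by (simp add: gauss_def[of 1 0])
    then show ?thesis
      by (simp only: of_real_eq_iff) simp
  qed
  finally show ?thesis
    by simp
qed

text \<open>The kernel concentrates at the diagonal as \<open>s \<rightarrow> 0\<close>; substituting \<open>y = x + s z\<close> reduces this to
  dominated convergence.\<close>

lemma gauss_kernel_approximate_identity:
  fixes f :: "'a::euclidean_space \<Rightarrow> complex"
  assumes f: "continuous_on UNIV f" "bounded (range f)"
    and s: "\<And>n. s n > 0" "s \<longlonglongrightarrow> 0"
  shows "(\<lambda>n. LINT y|lebesgue. f y * of_real (gauss_kernel (s n) (y - x))) \<longlonglongrightarrow> f x"
proof -
  have [measurable]: "f \<in> borel_measurable borel"
    using f(1) by (rule borel_measurable_continuous_onI)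
  obtain K where K: "\<And>x. cmod (f x) \<le> K"
    using f(2) by (auto simp: bounded_iff)
  let ?G = "\<lambda>z::'a. gauss_kernel 1 z"
  have G: "integrable lborel ?G"
    using integrable_gauss[of 1 "0::'a"] by (simp add: gauss_kernel_def integrable_lebesgue_lborel)
  have eq: "(LINT y|lebesgue. f y * of_real (gauss_kernel (s n) (y - x)))
      = (LINT z|lborel. f (x + s n *\<^sub>R z) * of_real (?G z))" for n
  proof -
    have "(LINT y|lebesgue. f y * of_real (gauss_kernel (s n) (y - x)))
        = (LINT y|lborel. f y * of_real (gauss_kernel (s n) (y - x)))"
      by (rule integral_completion) measurable
    also have "\<dots> = s n ^ DIM('a) *\<^sub>R (LINT z|lborel. f (x + s n *\<^sub>R z) * of_real (gauss_kernel (s n) (s n *\<^sub>R z)))"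
      using s(1)[of n] by (subst integral_lborel_affine[of _ "s n" x]) auto
    also have "\<dots> = (LINT z|lborel. s n ^ DIM('a) *\<^sub>R (f (x + s n *\<^sub>R z) * of_real (gauss_kernel (s n) (s n *\<^sub>R z))))"
      by simp
    also have "\<dots> = (LINT z|lborel. f (x + s n *\<^sub>R z) * of_real (?G z))"
      using s(1)[of n]
      by (intro Bochner_Integration.integral_cong)
        (auto simp: gauss_kernel_def gauss_scaleR[of "1 / s n"] scaleR_conv_of_real power_mult_distrib)
    finally show ?thesis .
  qed
  have "(\<lambda>n. LINT z|lborel. f (x + s n *\<^sub>R z) * of_real (?G z)) \<longlonglongrightarrow> (LINT z|lborel. f x * of_real (?G z))"
  proof (rule integral_dominated_convergence[where w="\<lambda>z. K * ?G z"])
    show "AE z in lborel. (\<lambda>n. f (x + s n *\<^sub>R z) * of_real (?G z)) \<longlonglongrightarrow> f x * of_real (?G z)"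
    proof (intro AE_I2 tendsto_mult_right)
      fix z
      have "(\<lambda>n. x + s n *\<^sub>R z) \<longlonglongrightarrow> x + 0 *\<^sub>R z"
        by (intro tendsto_intros s)
      then show "(\<lambda>n. f (x + s n *\<^sub>R z)) \<longlonglongrightarrow> f x"
        using f(1) continuous_on_tendsto_compose[of UNIV f] by simp
    qed
    show "AE z in lborel. norm (f (x + s n *\<^sub>R z) * of_real (?G z)) \<le> K * ?G z" for n
      using K by (auto simp: norm_mult intro!: mult_right_mono)
  qed (use G in auto)
  also have "(LINT z|lborel. f x * of_real (?G z)) = f x * of_real (LINT z|lborel. ?G z)"
    by simp
  also have "(LINT z|lborel. ?G z) = 1"
  proof -
    have "ennreal (LINT z|lborel. ?G z) = (\<integral>\<^sup>+z. ennreal (?G z) \<partial>lborel)"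
      using G by (intro nn_integral_eq_integral[symmetric]) auto
    also have "\<dots> = 1"
      using nn_integral_gauss_kernel[of 1 "0::'a"] by (simp add: nn_integral_completion)
    finally show ?thesis
      using ennreal_eq_1 by blast
  qed
  finally show ?thesis
    by (simp add: eq)
qed

section \<open>The Fourier transform on \<open>L\<^sup>1 \<inter> L\<^sup>2\<close>\<close>

text \<open>The Bochner integral of a non-integrable function is 0, which settles that case;
  iterated integrals can thus be estimated before the inner integrals are known to exist.\<close>

lemma norm_integral_le_nn_integral:
  fixes f :: "'a \<Rightarrow> 'b::{banach,second_countable_topology}"
  shows "ennreal (norm (integral\<^sup>L M f)) \<le> (\<integral>\<^sup>+x. ennreal (norm (f x)) \<partial>M)"
  by (cases "integrable M f") (auto intro: integral_norm_bound_ennreal simp: not_integrable_integral_eq)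

lemma sigma_finite_lebesgue: "sigma_finite_measure (lebesgue :: 'a::euclidean_space measure)"
proof
  obtain A :: "'a set set" where A: "countable A" "A \<subseteq> sets lborel" "\<Union> A = space lborel"
      "\<forall>a\<in>A. emeasure lborel a \<noteq> \<infinity>"
    using lborel.sigma_finite_countable by blast
  then show "\<exists>A::'a set set. countable A \<and> A \<subseteq> sets lebesgue \<and> \<Union> A = space lebesgue \<and>
      (\<forall>a\<in>A. emeasure lebesgue a \<noteq> \<infinity>)"
    by (intro exI[of _ A]) (auto simp: subset_iff)
qed

interpretation lebesgue: sigma_finite_measure "lebesgue :: 'a::euclidean_space measure"
  by (rule sigma_finite_lebesgue)

interpretation lebesgue_pair: pair_sigma_finite "lebesgue :: 'a::euclidean_space measure" "lebesgue :: 'b::euclidean_space measure" ..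

text \<open>The sign is a parameter so that one set of estimates serves the transform
  (\<open>c = - 1\<close>) and, up to a factor, its inverse (\<open>c = 1\<close>).\<close>

definition fourier_int :: "real \<Rightarrow> ('a::euclidean_space \<Rightarrow> complex) \<Rightarrow> 'a \<Rightarrow> complex" where
  "fourier_int c f \<xi> = (LINT x|lebesgue. cis (c * (x \<bullet> \<xi>)) * f x)"

lemma fourier_integral_eq: "fourier_integral = fourier_int (- 1)"
  by (simp add: fun_eq_iff fourier_integral_def fourier_int_def)

lemma measurable_lebesgue_id [measurable]: "(\<lambda>x. x) \<in> lebesgue \<rightarrow>\<^sub>M borel"
  using measurable_completion[of "\<lambda>x. x" lborel borel] by simp

lemma measurable_pair_lebesgue [measurable]:
  "fst \<in> (lebesgue \<Otimes>\<^sub>M M) \<rightarrow>\<^sub>M borel" "snd \<in> (M \<Otimes>\<^sub>M lebesgue) \<rightarrow>\<^sub>M borel"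
  using measurable_compose[OF measurable_fst measurable_lebesgue_id]
    measurable_compose[OF measurable_snd measurable_lebesgue_id] by auto

lemma integrable_cis_mult:
  "integrable lebesgue f \<Longrightarrow> integrable lebesgue (\<lambda>x. cis (c * (x \<bullet> \<xi>)) * f x)"
  by (rule Bochner_Integration.integrable_bound[of _ f]) (auto simp: norm_mult)

lemma integrable_pair_lebesgue:
  fixes a :: "'a::euclidean_space \<Rightarrow> complex" and b :: "'b::euclidean_space \<Rightarrow> complex"
  assumes "integrable lebesgue a" "integrable lebesgue b"
  shows "integrable (lebesgue \<Otimes>\<^sub>M lebesgue) (\<lambda>(x, y). a x * b y)"
proof (rule lebesgue_pair.Fubini_integrable)
  have [measurable]: "a \<in> borel_measurable lebesgue" "b \<in> borel_measurable lebesgue"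
    using assms by auto
  show "(\<lambda>(x, y). a x * b y) \<in> borel_measurable (lebesgue \<Otimes>\<^sub>M lebesgue)"
    by measurable
  show "integrable lebesgue (\<lambda>x. LINT y|lebesgue. norm (case (x, y) of (x, y) \<Rightarrow> a x * b y))"
    using assms by (simp add: norm_mult)
  show "AE x in lebesgue. integrable lebesgue (\<lambda>y. case (x, y) of (x, y) \<Rightarrow> a x * b y)"
    using assms by simp
qed

lemma fourier_int_measurable [measurable]:
  assumes [measurable]: "f \<in> borel_measurable lebesgue"
  shows "fourier_int c f \<in> borel_measurable lebesgue"
proof -
  have "(\<lambda>\<xi>. LINT x|lebesgue. cis (c * (x \<bullet> \<xi>)) * f x) \<in> borel_measurable lebesgue"
    by (rule lebesgue.borel_measurable_lebesgue_integral) measurable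
  then show ?thesis
    by (simp add: fourier_int_def[abs_def])
qed

lemma fourier_int_bound:
  assumes "integrable lebesgue f"
  shows "cmod (fourier_int c f \<xi>) \<le> (LINT x|lebesgue. cmod (f x))"
proof -
  have "cmod (fourier_int c f \<xi>) \<le> (LINT x|lebesgue. cmod (cis (c * (x \<bullet> \<xi>)) * f x))"
    unfolding fourier_int_def by (rule integral_norm_bound)
  then show ?thesis
    by (simp add: norm_mult)
qed

lemma fourier_int_add:
  "integrable lebesgue f \<Longrightarrow> integrable lebesgue g \<Longrightarrow>
    fourier_int c (\<lambda>x. f x + g x) = (\<lambda>\<xi>. fourier_int c f \<xi> + fourier_int c g \<xi>)"
  by (simp add: fun_eq_iff fourier_int_def distrib_left integrable_cis_mult)

lemma fourier_int_scaleR: "fourier_int c (\<lambda>x. r *\<^sub>R f x) = (\<lambda>\<xi>. r *\<^sub>R fourier_int c f \<xi>)"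
  by (simp add: fun_eq_iff fourier_int_def)

lemma fourier_int_cong_AE:
  assumes [measurable]: "f \<in> borel_measurable lebesgue" "g \<in> borel_measurable lebesgue"
    and "AE x in lebesgue. f x = g x"
  shows "fourier_int c f = fourier_int c g"
  unfolding fourier_int_def fun_eq_iff using assms(3)
  by (intro allI integral_cong_AE) auto

text \<open>Fubini's theorem, the kernel being symmetric in \<open>x\<close> and
  \<open>\<xi>\<close>. Moving the transform from one factor to the other is the source of both the
  norm bound and the inversion formula.\<close>

lemma fourier_int_multiplication_formula:
  fixes a b :: "'a::euclidean_space \<Rightarrow> complex"
  assumes "integrable lebesgue a" "integrable lebesgue b"
  shows "(LINT \<xi>|lebesgue. fourier_int c a \<xi> * b \<xi>) = (LINT x|lebesgue. a x * fourier_int c b x)"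
proof -
  have [measurable]: "a \<in> borel_measurable lebesgue" "b \<in> borel_measurable lebesgue"
    using assms by auto
  have i: "integrable (lebesgue \<Otimes>\<^sub>M lebesgue) (\<lambda>(x, \<xi>). cis (c * (x \<bullet> \<xi>)) * a x * b \<xi>)"
    by (rule Bochner_Integration.integrable_bound[OF integrable_pair_lebesgue[OF assms]])
      (auto simp: norm_mult split_beta)
  have "(LINT \<xi>|lebesgue. fourier_int c a \<xi> * b \<xi>)
      = (LINT \<xi>|lebesgue. LINT x|lebesgue. cis (c * (x \<bullet> \<xi>)) * a x * b \<xi>)"
    by (simp add: fourier_int_def)
  also have "\<dots> = (LINT x|lebesgue. LINT \<xi>|lebesgue. cis (c * (x \<bullet> \<xi>)) * a x * b \<xi>)"
    by (rule lebesgue_pair.Fubini_integral[OF i])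
  also have "\<dots> = (LINT x|lebesgue. LINT \<xi>|lebesgue. a x * (cis (c * (\<xi> \<bullet> x)) * b \<xi>))"
    by (simp add: mult_ac inner_commute)
  also have "\<dots> = (LINT x|lebesgue. a x * fourier_int c b x)"
    by (simp add: fourier_int_def)
  finally show ?thesis .
qed

text \<open>The phase translates the transformed Gaussian to the point \<open>x\<close>; the sign
  \<open>c\<close> disappears because the kernel depends only on the norm.\<close>

lemma fourier_int_modulated_gauss:
  fixes x y :: "'a::euclidean_space"
  assumes c: "\<bar>c\<bar> = 1" and s: "s > 0"
  shows "fourier_int c (\<lambda>\<xi>. cis (- c * (\<xi> \<bullet> x)) * of_real (gauss s \<xi>)) y
    = of_real ((2 * pi) ^ DIM('a) * gauss_kernel s (y - x))"
proof -
  have "fourier_int c (\<lambda>\<xi>. cis (- c * (\<xi> \<bullet> x)) * of_real (gauss s \<xi>)) y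
      = (LINT \<xi>|lebesgue. cis (\<xi> \<bullet> (c *\<^sub>R (y - x))) * of_real (gauss s \<xi>))"
    unfolding fourier_int_def
    by (intro Bochner_Integration.integral_cong)
      (simp_all add: cis_mult inner_diff_right algebra_simps flip: mult.assoc)
  also have "\<dots> = of_real ((2 * pi) ^ DIM('a) * gauss_kernel s (c *\<^sub>R (y - x)))"
    by (rule fourier_gauss[OF s])
  also have "gauss_kernel s (c *\<^sub>R (y - x)) = gauss_kernel s (y - x)"
    using c by (simp add: gauss_kernel_def gauss_def)
  finally show ?thesis .
qed

lemma integrable_modulated_gauss:
  "s > 0 \<Longrightarrow> integrable lebesgue (\<lambda>\<xi>. cis (c * (\<xi> \<bullet> x)) * of_real (gauss s \<xi>) :: complex)"
  using integrable_gauss[of s 0] by (intro integrable_cis_mult integrable_of_real) simp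

text \<open>The multiplication formula with a modulated Gaussian as second factor: damping on the
  Fourier side becomes averaging against \<open>gauss_kernel\<close>, even if the transform of
  \<open>f\<close> itself is not integrable.\<close>

lemma gauss_regularized_inversion:
  fixes f :: "'a::euclidean_space \<Rightarrow> complex"
  assumes f: "integrable lebesgue f" and c: "\<bar>c\<bar> = 1" and s: "s > 0"
  shows "fourier_int (- c) (\<lambda>\<xi>. of_real (gauss s \<xi>) * fourier_int c f \<xi>) x
    = (2 * pi) ^ DIM('a) * (LINT y|lebesgue. f y * of_real (gauss_kernel s (y - x)))"
proof -
  have "fourier_int (- c) (\<lambda>\<xi>. of_real (gauss s \<xi>) * fourier_int c f \<xi>) x
      = (LINT \<xi>|lebesgue. fourier_int c f \<xi> * (cis (- c * (\<xi> \<bullet> x)) * of_real (gauss s \<xi>)))"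
    by (subst fourier_int_def) (simp add: mult_ac)
  also have "\<dots> = (LINT y|lebesgue. f y * of_real ((2 * pi) ^ DIM('a) * gauss_kernel s (y - x)))"
    by (subst fourier_int_multiplication_formula[OF f integrable_modulated_gauss[OF s]])
      (simp only: fourier_int_modulated_gauss[OF c s])
  also have "\<dots> = (LINT y|lebesgue. of_real ((2 * pi) ^ DIM('a)) * (f y * of_real (gauss_kernel s (y - x))))"
    by (simp add: mult_ac)
  also have "\<dots> = (2 * pi) ^ DIM('a) * (LINT y|lebesgue. f y * of_real (gauss_kernel s (y - x)))"
    by (subst integral_mult_right_zero) simp
  finally show ?thesis .
qed

text \<open>Schur's test: the product |f x| |f y| is at most the mean of the squares, and the kernel
  has mass one in either variable.\<close>

lemma nn_integral_gauss_kernel_form: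
  fixes f :: "'a::euclidean_space \<Rightarrow> complex"
  assumes [measurable]: "f \<in> borel_measurable lebesgue" and s: "s > 0"
  shows "(\<integral>\<^sup>+x. \<integral>\<^sup>+y. ennreal (cmod (f x) * cmod (f y) * gauss_kernel s (y - x)) \<partial>lebesgue \<partial>lebesgue)
    \<le> (\<integral>\<^sup>+x. ennreal ((cmod (f x))\<^sup>2) \<partial>lebesgue)"
proof -
  let ?K = "\<lambda>x y. ennreal (gauss_kernel s (y - x))" and ?F = "\<lambda>x. ennreal ((cmod (f x))\<^sup>2 / 2)"
  have pt: "ennreal (cmod (f x) * cmod (f y) * gauss_kernel s (y - x)) \<le> ?F x * ?K x y + ?F y * ?K x y" for x y
  proof -
    have "cmod (f x) * cmod (f y) \<le> (cmod (f x))\<^sup>2 / 2 + (cmod (f y))\<^sup>2 / 2"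
      using sum_squares_bound[of "cmod (f x)" "cmod (f y)"] by simp
    then have "cmod (f x) * cmod (f y) * gauss_kernel s (y - x)
        \<le> ((cmod (f x))\<^sup>2 / 2 + (cmod (f y))\<^sup>2 / 2) * gauss_kernel s (y - x)"
      using s by (intro mult_right_mono) auto
    then show ?thesis
      using s by (simp add: ennreal_leI distrib_right flip: ennreal_mult ennreal_plus)
  qed
  have "(\<integral>\<^sup>+x. \<integral>\<^sup>+y. ennreal (cmod (f x) * cmod (f y) * gauss_kernel s (y - x)) \<partial>lebesgue \<partial>lebesgue)
      \<le> (\<integral>\<^sup>+x. \<integral>\<^sup>+y. ?F x * ?K x y + ?F y * ?K x y \<partial>lebesgue \<partial>lebesgue)"
    by (intro nn_integral_mono pt)
  also have "\<dots> = (\<integral>\<^sup>+x. (\<integral>\<^sup>+y. ?F x * ?K x y \<partial>lebesgue) + (\<integral>\<^sup>+y. ?F y * ?K x y \<partial>lebesgue) \<partial>lebesgue)"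
    by (intro nn_integral_cong nn_integral_add) measurable
  also have "\<dots> = (\<integral>\<^sup>+x. \<integral>\<^sup>+y. ?F x * ?K x y \<partial>lebesgue \<partial>lebesgue) + (\<integral>\<^sup>+x. \<integral>\<^sup>+y. ?F y * ?K x y \<partial>lebesgue \<partial>lebesgue)"
    by (rule nn_integral_add) measurable
  also have "(\<integral>\<^sup>+x. \<integral>\<^sup>+y. ?F y * ?K x y \<partial>lebesgue \<partial>lebesgue) = (\<integral>\<^sup>+y. \<integral>\<^sup>+x. ?F y * ?K x y \<partial>lebesgue \<partial>lebesgue)"
    by (rule lebesgue_pair.Fubini') measurable
  also have "\<dots> = (\<integral>\<^sup>+y. ?F y \<partial>lebesgue)"
  proof (rule nn_integral_cong)
    fix y
    have "(\<integral>\<^sup>+x. ?F y * ?K x y \<partial>lebesgue) = ?F y * (\<integral>\<^sup>+x. ?K x y \<partial>lebesgue)"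
      by (rule nn_integral_cmult) measurable
    then show "(\<integral>\<^sup>+x. ?F y * ?K x y \<partial>lebesgue) = ?F y"
      using s by (simp add: gauss_kernel_commute[of s y] nn_integral_gauss_kernel)
  qed
  also have "(\<integral>\<^sup>+x. \<integral>\<^sup>+y. ?F x * ?K x y \<partial>lebesgue \<partial>lebesgue) = (\<integral>\<^sup>+x. ?F x \<partial>lebesgue)"
  proof (rule nn_integral_cong)
    fix x
    have "(\<integral>\<^sup>+y. ?F x * ?K x y \<partial>lebesgue) = ?F x * (\<integral>\<^sup>+y. ?K x y \<partial>lebesgue)"
      by (rule nn_integral_cmult) measurable
    then show "(\<integral>\<^sup>+y. ?F x * ?K x y \<partial>lebesgue) = ?F x"
      using s by (simp add: nn_integral_gauss_kernel)
  qed
  also have "(\<integral>\<^sup>+x. ?F x \<partial>lebesgue) + (\<integral>\<^sup>+x. ?F x \<partial>lebesgue) = (\<integral>\<^sup>+x. ?F x + ?F x \<partial>lebesgue)"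
    by (rule nn_integral_add[symmetric]) measurable
  also have "\<dots> = (\<integral>\<^sup>+x. ennreal ((cmod (f x))\<^sup>2) \<partial>lebesgue)"
    by (simp flip: ennreal_plus)
  finally show ?thesis .
qed

text \<open>Half of Plancherel's theorem. With a Gaussian weight the squared norm of the transform
  is a multiple of the quadratic form of \<open>gauss_kernel\<close> at \<open>f\<close>, which
  Schur's test controls; Fatou's lemma removes the weight.\<close>

lemma fourier_int_L2_bound:
  fixes f :: "'a::euclidean_space \<Rightarrow> complex"
  assumes f: "integrable lebesgue f" "square_integrable f" and c: "\<bar>c\<bar> = 1"
  shows "square_integrable (fourier_int c f)"
    and "L2_norm (fourier_int c f) \<le> sqrt ((2 * pi) ^ DIM('a)) * L2_norm f"
proof -
  let ?F = "fourier_int c f" and ?C = "(2 * pi) ^ DIM('a)"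
  have [measurable]: "f \<in> borel_measurable lebesgue"
    using f by auto
  obtain B where B: "\<And>\<xi>. cmod (?F \<xi>) \<le> B" and "B \<ge> 0"
    using fourier_int_bound[OF f(1), of c] by (metis norm_ge_zero order_trans)
  \<comment> \<open>The square root makes exactly one factor \<open>gauss s\<close> appear in the
    squared modulus.\<close>
  have reg: "square_integrable (\<lambda>\<xi>. sqrt (gauss s \<xi>) * ?F \<xi>) \<and>
      L2_norm (\<lambda>\<xi>. sqrt (gauss s \<xi>) * ?F \<xi>) \<le> sqrt ?C * L2_norm f" if s: "s > 0" for s
  proof -
    have g: "integrable lebesgue (\<lambda>\<xi>::'a. gauss s \<xi>)"
      using integrable_gauss[of s 0] s by simp
    have gF: "integrable lebesgue (\<lambda>\<xi>. of_real (gauss s \<xi>) * ?F \<xi>)"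
      by (rule Bochner_Integration.integrable_bound[OF integrable_mult_left[OF g, of B]])
        (use B \<open>B \<ge> 0\<close> in \<open>auto simp: norm_mult intro!: mult_left_mono\<close>)
    have sq: "(cmod (sqrt (gauss s \<xi>) * ?F \<xi>))\<^sup>2 = gauss s \<xi> * (cmod (?F \<xi>))\<^sup>2" for \<xi>
      by (simp add: norm_mult power_mult_distrib)
    have int: "integrable lebesgue (\<lambda>\<xi>. gauss s \<xi> * (cmod (?F \<xi>))\<^sup>2)"
      by (rule Bochner_Integration.integrable_bound[OF integrable_mult_left[OF g, of "B\<^sup>2"]])
        (use B \<open>B \<ge> 0\<close> in \<open>auto simp: norm_mult intro!: mult_left_mono power_mono\<close>)
    have si: "square_integrable (\<lambda>\<xi>. sqrt (gauss s \<xi>) * ?F \<xi>)"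
      unfolding square_integrable_def sq using int by simp
    \<comment> \<open>The squared modulus is the transform times its conjugate, and the conjugate is
      again a transform, of opposite sign, to which the multiplication formula applies.\<close>
    have cnj: "cnj (?F \<xi>) = fourier_int (- c) (\<lambda>x. cnj (f x)) \<xi>" for \<xi>
    proof -
      have "cnj (?F \<xi>) = (LINT x|lebesgue. cnj (cis (c * (x \<bullet> \<xi>)) * f x))"
        unfolding fourier_int_def
        by (rule integral_bounded_linear[OF bounded_linear_cnj, symmetric]) (intro integrable_cis_mult f)
      then show ?thesis
        by (simp add: fourier_int_def cis_cnj)
    qed
    have icnj: "integrable lebesgue (\<lambda>x. cnj (f x))"
      using f by simp
    have "complex_of_real (LINT \<xi>|lebesgue. gauss s \<xi> * (cmod (?F \<xi>))\<^sup>2)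
        = (LINT \<xi>|lebesgue. of_real (gauss s \<xi> * (cmod (?F \<xi>))\<^sup>2))"
      by (rule integral_complex_of_real[symmetric])
    also have "\<dots> = (LINT \<xi>|lebesgue. fourier_int (- c) (\<lambda>x. cnj (f x)) \<xi> * (of_real (gauss s \<xi>) * ?F \<xi>))"
      by (intro Bochner_Integration.integral_cong refl)
        (simp only: of_real_mult complex_norm_square cnj[symmetric] mult_ac)
    also have "\<dots> = (LINT x|lebesgue. cnj (f x) * fourier_int (- c) (\<lambda>\<xi>. of_real (gauss s \<xi>) * ?F \<xi>) x)"
      by (rule fourier_int_multiplication_formula[OF icnj gF])
    also have "\<dots> = (LINT x|lebesgue. ?C * (LINT y|lebesgue. cnj (f x) * f y * of_real (gauss_kernel s (y - x))))"
      by (simp only: gauss_regularized_inversion[OF f(1) c s] mult.assoc integral_mult_right_zero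
          mult.left_commute[of "cnj _" "of_real _"])
    also have "\<dots> = ?C * (LINT x|lebesgue. LINT y|lebesgue. cnj (f x) * f y * of_real (gauss_kernel s (y - x)))"
      by (rule integral_mult_right_zero)
    finally have "ennreal (cmod (of_real (LINT \<xi>|lebesgue. gauss s \<xi> * (cmod (?F \<xi>))\<^sup>2)))
      = ennreal ?C * ennreal (cmod (LINT x|lebesgue. LINT y|lebesgue. cnj (f x) * f y * of_real (gauss_kernel s (y - x))))"
      by (simp add: norm_mult ennreal_mult norm_power)
    also have "\<dots> \<le> ennreal ?C * (\<integral>\<^sup>+x. \<integral>\<^sup>+y. ennreal (cmod (f x) * cmod (f y) * gauss_kernel s (y - x)) \<partial>lebesgue \<partial>lebesgue)"
    proof (rule mult_left_mono)
      have "ennreal (cmod (LINT x|lebesgue. LINT y|lebesgue. cnj (f x) * f y * of_real (gauss_kernel s (y - x))))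
        \<le> (\<integral>\<^sup>+x. ennreal (cmod (LINT y|lebesgue. cnj (f x) * f y * of_real (gauss_kernel s (y - x)))) \<partial>lebesgue)"
        by (rule norm_integral_le_nn_integral)
      also have "\<dots> \<le> (\<integral>\<^sup>+x. \<integral>\<^sup>+y. ennreal (cmod (cnj (f x) * f y * of_real (gauss_kernel s (y - x)))) \<partial>lebesgue \<partial>lebesgue)"
        by (intro nn_integral_mono norm_integral_le_nn_integral)
      also have "\<dots> = (\<integral>\<^sup>+x. \<integral>\<^sup>+y. ennreal (cmod (f x) * cmod (f y) * gauss_kernel s (y - x)) \<partial>lebesgue \<partial>lebesgue)"
        using s by (simp add: norm_mult)
      finally show "ennreal (cmod (LINT x|lebesgue. LINT y|lebesgue. cnj (f x) * f y * of_real (gauss_kernel s (y - x))))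
        \<le> (\<integral>\<^sup>+x. \<integral>\<^sup>+y. ennreal (cmod (f x) * cmod (f y) * gauss_kernel s (y - x)) \<partial>lebesgue \<partial>lebesgue)" .
    qed simp
    also have "\<dots> \<le> ennreal ?C * (\<integral>\<^sup>+x. ennreal ((cmod (f x))\<^sup>2) \<partial>lebesgue)"
      by (intro mult_left_mono nn_integral_gauss_kernel_form s) auto
    also have "\<dots> = ennreal (?C * (L2_norm f)\<^sup>2)"
      using f by (simp add: ennreal_mult flip: L2_norm_nn_integral)
    finally have le: "(LINT \<xi>|lebesgue. gauss s \<xi> * (cmod (?F \<xi>))\<^sup>2) \<le> ?C * (L2_norm f)\<^sup>2"
      by (simp add: ennreal_le_iff integral_nonneg)
    have "L2_norm (\<lambda>\<xi>. sqrt (gauss s \<xi>) * ?F \<xi>) \<le> sqrt (?C * (L2_norm f)\<^sup>2)"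
      unfolding L2_norm_def[of "\<lambda>\<xi>. sqrt (gauss s \<xi>) * ?F \<xi>"] sq by (rule real_sqrt_le_mono[OF le])
    with si show ?thesis
      by (simp add: real_sqrt_mult)
  qed
  let ?s = "\<lambda>n. 1 / real (Suc n)"
  have lim: "(\<lambda>n. complex_of_real (sqrt (gauss (?s n) \<xi>)) * ?F \<xi>) \<longlonglongrightarrow> ?F \<xi>" for \<xi>
  proof -
    have "(\<lambda>n. gauss (?s n) \<xi>) \<longlonglongrightarrow> gauss 0 \<xi>"
      unfolding gauss_def using LIMSEQ_inverse_real_of_nat
      by (intro tendsto_intros) (auto simp: inverse_eq_divide)
    then have "(\<lambda>n. complex_of_real (sqrt (gauss (?s n) \<xi>)) * ?F \<xi>) \<longlonglongrightarrow> of_real (sqrt (gauss 0 \<xi>)) * ?F \<xi>"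
      by (intro tendsto_intros)
    then show ?thesis
      by (simp add: gauss_def[of 0])
  qed
  note fatou = square_integrable_Fatou[of "\<lambda>n \<xi>. complex_of_real (sqrt (gauss (?s n) \<xi>)) * ?F \<xi>" "sqrt ?C * L2_norm f" ?F]
  show "square_integrable ?F"
    by (rule fatou(1)) (use reg lim in auto)
  show "L2_norm ?F \<le> sqrt ?C * L2_norm f"
    by (rule fatou(2)) (use reg lim in auto)
qed

section \<open>The Fourier transform on \<open>L\<^sup>2\<close>\<close>

abbreviation trunc :: "nat \<Rightarrow> ('a::euclidean_space \<Rightarrow> complex) \<Rightarrow> 'a \<Rightarrow> complex" where
  "trunc n f \<equiv> \<lambda>x. indicator (ball 0 (real n)) x *\<^sub>R f x"

text \<open>The extension by density, written out along truncations to balls, which are integrable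
  as well as square integrable.\<close>

definition fourier_op :: "real \<Rightarrow> 'a::euclidean_space L2 \<Rightarrow> 'a L2" where
  "fourier_op c f = lim (\<lambda>n. abs_L2 (fourier_int c (trunc n (rep_L2 f))))"

lemma fourier_int_L2_diff_bound:
  fixes f g :: "'a::euclidean_space \<Rightarrow> complex"
  assumes "integrable lebesgue f" "square_integrable f" "integrable lebesgue g" "square_integrable g"
    and c: "\<bar>c\<bar> = 1"
  shows "norm (abs_L2 (fourier_int c f) - abs_L2 (fourier_int c g))
    \<le> sqrt ((2 * pi) ^ DIM('a)) * norm (abs_L2 f - abs_L2 g)"
proof -
  have "(\<lambda>\<xi>. fourier_int c f \<xi> - fourier_int c g \<xi>) = fourier_int c (\<lambda>x. f x - g x)"
    using fourier_int_add[of f "\<lambda>x. (- 1) *\<^sub>R g x" c] fourier_int_scaleR[of c "- 1" g] assms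
    by (simp add: fun_eq_iff)
  then show ?thesis
    using assms fourier_int_L2_bound(2)[of "\<lambda>x. f x - g x" c]
    by (simp add: abs_L2_diff fourier_int_L2_bound(1) norm_abs_L2 square_integrable_diff)
qed

text \<open>The truncations form a Cauchy sequence, the Fourier integral is Lipschitz on them, and
  \<open>L2\<close> is complete.\<close>

lemma fourier_op_LIMSEQ:
  fixes f :: "'a::euclidean_space L2"
  assumes c: "\<bar>c\<bar> = 1"
  shows "(\<lambda>n. abs_L2 (fourier_int c (trunc n (rep_L2 f)))) \<longlonglongrightarrow> fourier_op c f"
proof -
  let ?X = "\<lambda>n. abs_L2 (trunc n (rep_L2 f))" and ?C = "sqrt ((2 * pi) ^ DIM('a))"
  note tr = L2_truncation_dense[of "rep_L2 f", OF square_integrable_rep_L2]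
  have "Cauchy ?X"
    using tr(3) by (rule LIMSEQ_imp_Cauchy)
  have "Cauchy (\<lambda>n. abs_L2 (fourier_int c (trunc n (rep_L2 f))))"
  proof (rule CauchyI)
    fix e :: real
    assume "e > 0"
    then obtain M where M: "\<And>m n. m \<ge> M \<Longrightarrow> n \<ge> M \<Longrightarrow> norm (?X m - ?X n) < e / ?C"
      using CauchyD[OF \<open>Cauchy ?X\<close>, of "e / ?C"] by auto
    have "norm (abs_L2 (fourier_int c (trunc m (rep_L2 f))) - abs_L2 (fourier_int c (trunc n (rep_L2 f)))) < e"
      if "m \<ge> M" "n \<ge> M" for m n
    proof -
      have "norm (abs_L2 (fourier_int c (trunc m (rep_L2 f))) - abs_L2 (fourier_int c (trunc n (rep_L2 f))))
          \<le> ?C * norm (?X m - ?X n)"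
        by (rule fourier_int_L2_diff_bound[OF tr(2) tr(1) tr(2) tr(1) c])
      also have "\<dots> < e"
        using M[OF that] by (simp add: field_simps)
      finally show ?thesis .
    qed
    then show "\<exists>M. \<forall>m\<ge>M. \<forall>n\<ge>M. norm (abs_L2 (fourier_int c (trunc m (rep_L2 f))) - abs_L2 (fourier_int c (trunc n (rep_L2 f)))) < e"
      by blast
  qed
  then show ?thesis
    unfolding fourier_op_def by (simp add: Cauchy_convergent_iff convergent_LIMSEQ_iff)
qed

text \<open>The truncated function is \<open>rep_L2 (abs_L2 f)\<close>, which equals
  \<open>f\<close> only almost everywhere; the Lipschitz bound compares classes and is insensitive
  to this.\<close>

lemma fourier_op_abs:
  fixes f :: "'a::euclidean_space \<Rightarrow> complex"
  assumes f: "integrable lebesgue f" "square_integrable f" and c: "\<bar>c\<bar> = 1"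
  shows "fourier_op c (abs_L2 f) = abs_L2 (fourier_int c f)"
proof -
  let ?g = "rep_L2 (abs_L2 f)" and ?C = "sqrt ((2 * pi) ^ DIM('a))"
  note tr = L2_truncation_dense[of ?g, OF square_integrable_rep_L2]
  have "(\<lambda>n. ?C * norm (abs_L2 (trunc n ?g) - abs_L2 f)) \<longlonglongrightarrow> ?C * norm (abs_L2 ?g - abs_L2 f)"
    by (intro tendsto_intros tr)
  then have "(\<lambda>n. ?C * norm (abs_L2 (trunc n ?g) - abs_L2 f)) \<longlonglongrightarrow> 0"
    by simp
  moreover have "\<forall>\<^sub>F n in sequentially. norm (abs_L2 (fourier_int c (trunc n ?g)) - abs_L2 (fourier_int c f))
      \<le> ?C * norm (abs_L2 (trunc n ?g) - abs_L2 f)"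
    by (intro always_eventually allI fourier_int_L2_diff_bound tr f c)
  ultimately have "(\<lambda>n. abs_L2 (fourier_int c (trunc n ?g)) - abs_L2 (fourier_int c f)) \<longlonglongrightarrow> 0"
    by (rule Lim_null_comparison[rotated])
  then have "(\<lambda>n. abs_L2 (fourier_int c (trunc n ?g))) \<longlonglongrightarrow> abs_L2 (fourier_int c f)"
    by (rule LIM_zero_cancel)
  then show ?thesis
    by (rule LIMSEQ_unique[OF fourier_op_LIMSEQ[OF c]])
qed

lemma norm_fourier_op_le:
  fixes f :: "'a::euclidean_space L2"
  assumes c: "\<bar>c\<bar> = 1"
  shows "norm (fourier_op c f) \<le> sqrt ((2 * pi) ^ DIM('a)) * norm f"
proof (rule LIMSEQ_le)
  note tr = L2_truncation_dense[of "rep_L2 f", OF square_integrable_rep_L2]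
  show "(\<lambda>n. norm (abs_L2 (fourier_int c (trunc n (rep_L2 f))))) \<longlonglongrightarrow> norm (fourier_op c f)"
    by (intro tendsto_norm fourier_op_LIMSEQ c)
  show "(\<lambda>n. sqrt ((2 * pi) ^ DIM('a)) * norm (abs_L2 (trunc n (rep_L2 f)))) \<longlonglongrightarrow> sqrt ((2 * pi) ^ DIM('a)) * norm f"
    using tr(3) by (intro tendsto_intros) simp
  show "\<exists>N. \<forall>n\<ge>N. norm (abs_L2 (fourier_int c (trunc n (rep_L2 f))))
      \<le> sqrt ((2 * pi) ^ DIM('a)) * norm (abs_L2 (trunc n (rep_L2 f)))"
    using fourier_int_L2_bound[OF tr(2) tr(1) c] tr(1) by (auto simp: norm_abs_L2)
qed

lemma bounded_linear_fourier_op: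
  fixes c :: real
  assumes c: "\<bar>c\<bar> = 1"
  shows "bounded_linear (fourier_op c :: 'a::euclidean_space L2 \<Rightarrow> 'a L2)"
proof (rule bounded_linear_intro)
  fix f g :: "'a L2" and r :: real
  note tr = L2_truncation_dense[OF square_integrable_rep_L2]
  have meas [measurable]: "trunc n (rep_L2 h) \<in> borel_measurable lebesgue" for n and h :: "'a L2"
    using tr(1) by (rule square_integrable_measurable)
  let ?T = "\<lambda>n h. abs_L2 (fourier_int c (trunc n (rep_L2 (h :: 'a L2))))"
  have "?T n (f + g) = ?T n f + ?T n g" for n
  proof -
    \<comment> \<open>Representatives are additive only almost everywhere; under the integral this
      becomes equality at every frequency.\<close>
    have "fourier_int c (trunc n (rep_L2 (f + g)))
        = fourier_int c (\<lambda>x. trunc n (rep_L2 f) x + trunc n (rep_L2 g) x)"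
    proof (rule fourier_int_cong_AE)
      show "AE x in lebesgue. trunc n (rep_L2 (f + g)) x = trunc n (rep_L2 f) x + trunc n (rep_L2 g) x"
        using rep_L2_add[of f g] by eventually_elim (simp add: scaleR_add_right)
    qed measurable
    then show ?thesis
      by (simp add: fourier_int_add tr abs_L2_add fourier_int_L2_bound(1) c)
  qed
  then have "(\<lambda>n. ?T n (f + g)) \<longlonglongrightarrow> fourier_op c f + fourier_op c g"
    using tendsto_add[OF fourier_op_LIMSEQ[OF c, of f] fourier_op_LIMSEQ[OF c, of g]] by simp
  then show "fourier_op c (f + g) = fourier_op c f + fourier_op c g"
    by (rule LIMSEQ_unique[OF fourier_op_LIMSEQ[OF c]])
  have "?T n (r *\<^sub>R f) = r *\<^sub>R ?T n f" for n
  proof -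
    have "fourier_int c (trunc n (rep_L2 (r *\<^sub>R f))) = fourier_int c (\<lambda>x. r *\<^sub>R trunc n (rep_L2 f) x)"
    proof (rule fourier_int_cong_AE)
      show "AE x in lebesgue. trunc n (rep_L2 (r *\<^sub>R f)) x = r *\<^sub>R trunc n (rep_L2 f) x"
        using rep_L2_scaleR[of r f] by eventually_elim simp
    qed measurable
    then show ?thesis
      by (simp only: fourier_int_scaleR) (simp add: tr abs_L2_scaleR fourier_int_L2_bound(1) c)
  qed
  then have "(\<lambda>n. ?T n (r *\<^sub>R f)) \<longlonglongrightarrow> r *\<^sub>R fourier_op c f"
    using tendsto_scaleR[OF tendsto_const fourier_op_LIMSEQ[OF c, of f]] by simp
  then show "fourier_op c (r *\<^sub>R f) = r *\<^sub>R fourier_op c f"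
    by (rule LIMSEQ_unique[OF fourier_op_LIMSEQ[OF c]])
  show "norm (fourier_op c f) \<le> norm f * sqrt ((2 * pi) ^ DIM('a))"
    using norm_fourier_op_le[OF c, of f] by (simp add: mult.commute)
qed

text \<open>The damped transforms \<open>W n\<close> converge in norm to the transform of
  \<open>g\<close>, hence so do their images under the opposite sign. Pointwise those images are
  averages of \<open>g\<close> against the approximate identity, and a norm limit and a pointwise
  limit must coincide.\<close>

lemma fourier_op_inversion_continuous:
  fixes g :: "'a::euclidean_space \<Rightarrow> complex"
  assumes g: "continuous_on UNIV g" "bounded (range g)" "integrable lebesgue g" "square_integrable g"
    and c: "\<bar>c\<bar> = 1"
  shows "fourier_op (- c) (fourier_op c (abs_L2 g)) = (2 * pi) ^ DIM('a) *\<^sub>R abs_L2 g"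
proof -
  let ?F = "fourier_int c g" and ?C = "(2 * pi) ^ DIM('a)"
  define s where "s n = 1 / real (Suc n)" for n
  have s: "s n > 0" for n
    by (simp add: s_def)
  have s_lim: "s \<longlonglongrightarrow> 0"
    unfolding s_def using LIMSEQ_inverse_real_of_nat by (simp add: inverse_eq_divide)
  have c': "\<bar>- c\<bar> = 1"
    using c by simp
  have [measurable]: "g \<in> borel_measurable lebesgue"
    using g by auto
  define W where "W n \<xi> = complex_of_real (gauss (s n) \<xi>) * ?F \<xi>" for n \<xi>
  have F: "square_integrable ?F"
    by (rule fourier_int_L2_bound(1)[OF g(3,4) c])
  have [measurable]: "?F \<in> borel_measurable lebesgue" "W n \<in> borel_measurable lebesgue" for n
    unfolding W_def by measurable
  have W_le: "cmod (W n \<xi>) \<le> cmod (?F \<xi>)" for n \<xi>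
    by (simp add: W_def norm_mult mult_left_le_one_le)
  have W_lim: "(\<lambda>n. W n \<xi>) \<longlonglongrightarrow> ?F \<xi>" for \<xi>
  proof -
    have "(\<lambda>n. gauss (s n) \<xi>) \<longlonglongrightarrow> gauss 0 \<xi>"
      unfolding gauss_def by (intro tendsto_intros s_lim) auto
    then have "(\<lambda>n. W n \<xi>) \<longlonglongrightarrow> of_real (gauss 0 \<xi>) * ?F \<xi>"
      unfolding W_def by (intro tendsto_intros)
    then show ?thesis
      by (simp add: gauss_def[of 0])
  qed
  have W_si: "square_integrable (W n)" for n
    by (rule L2_dominated_convergence(1)[OF F, of W ?F]) (simp_all add: W_lim W_le)
  have W_L2: "(\<lambda>n. abs_L2 (W n)) \<longlonglongrightarrow> abs_L2 ?F"
    by (rule L2_dominated_convergence(3)[OF F, of W ?F]) (simp_all add: W_lim W_le)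
  obtain B where B: "\<And>\<xi>. cmod (?F \<xi>) \<le> B" and "B \<ge> 0"
    using fourier_int_bound[OF g(3), of c] by (metis norm_ge_zero order_trans)
  have W_int: "integrable lebesgue (W n)" for n
  proof (rule Bochner_Integration.integrable_bound)
    show "integrable lebesgue (\<lambda>\<xi>::'a. gauss (s n) \<xi> * B)"
      using integrable_gauss[of "s n" "0 :: 'a"] s[of n] by simp
    show "AE \<xi> in lebesgue. cmod (W n \<xi>) \<le> norm (gauss (s n) \<xi> * B)"
      using B \<open>B \<ge> 0\<close> by (auto simp: W_def norm_mult intro!: mult_left_mono)
  qed simp
  let ?R = "\<lambda>n x. ?C * (LINT y|lebesgue. g y * of_real (gauss_kernel (s n) (y - x)))"
  have R: "fourier_int (- c) (W n) = ?R n" for n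
    unfolding W_def fun_eq_iff by (intro allI gauss_regularized_inversion[OF g(3) c s])
  have lim: "(\<lambda>n. fourier_op (- c) (abs_L2 (W n))) \<longlonglongrightarrow> fourier_op (- c) (abs_L2 ?F)"
    by (rule bounded_linear.tendsto[OF bounded_linear_fourier_op[OF c'] W_L2])
  have R_si: "square_integrable (?R n)" for n
    using fourier_int_L2_bound(1)[OF W_int W_si c', of n] by (simp only: R)
  have R_eq: "fourier_op (- c) (abs_L2 (W n)) = abs_L2 (?R n)" for n
    using fourier_op_abs[OF W_int W_si c', of n] by (simp only: R)
  have R_lim: "AE x in lebesgue. (\<lambda>n. ?R n x) \<longlonglongrightarrow> ?C *\<^sub>R g x"
  proof (rule AE_I2)
    fix x
    have "(\<lambda>n. ?R n x) \<longlonglongrightarrow> ?C * g x"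
      by (intro tendsto_mult_left gauss_kernel_approximate_identity g s s_lim)
    then show "(\<lambda>n. ?R n x) \<longlonglongrightarrow> ?C *\<^sub>R g x"
      by (simp add: scaleR_conv_of_real)
  qed
  have "abs_L2 (\<lambda>x. ?C *\<^sub>R g x) = fourier_op (- c) (abs_L2 ?F)"
    by (rule L2_limit_AE(2)[OF lim R_si R_eq _ R_lim]) measurable
  then show ?thesis
    using fourier_op_abs[OF g(3,4) c] by (simp add: abs_L2_scaleR g)
qed

text \<open>Both sides are continuous and additive in \<open>f\<close>, so the set where they agree
  meets the conditions of \<open>L2_dense_continuous\<close>.\<close>

lemma fourier_op_inversion:
  fixes f :: "'a::euclidean_space L2"
  assumes c: "\<bar>c\<bar> = 1"
  shows "fourier_op (- c) (fourier_op c f) = (2 * pi) ^ DIM('a) *\<^sub>R f"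
proof -
  have c': "\<bar>- c\<bar> = 1"
    using c by simp
  have bl: "bounded_linear (\<lambda>f :: 'a L2. fourier_op (- c) (fourier_op c f))"
    by (rule bounded_linear_compose[OF bounded_linear_fourier_op[OF c'] bounded_linear_fourier_op[OF c]])
  let ?S = "{f :: 'a L2. fourier_op (- c) (fourier_op c f) = (2 * pi) ^ DIM('a) *\<^sub>R f}"
  have "f \<in> ?S"
  proof (rule L2_dense_continuous)
    show "closed ?S"
      by (intro closed_Collect_eq linear_continuous_on bl bounded_linear_scaleR_right)
    show "f + g \<in> ?S" if "f \<in> ?S" "g \<in> ?S" for f g
      using that linear_add[OF bounded_linear.linear[OF bl], of f g] by (simp add: scaleR_add_right)
    show "abs_L2 g \<in> ?S" if "continuous_on UNIV g" "bounded (range g)" "integrable lebesgue g" "square_integrable g" for g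
      using fourier_op_inversion_continuous[OF that c] by simp
  qed
  then show ?thesis
    by simp
qed

text \<open>Discharges the definite description: a competitor agrees with
  \<open>fourier_op (- 1)\<close> on truncations and is continuous, hence agrees everywhere.\<close>

lemma fourier_L2_eq: "(fourier_L2 :: 'a::euclidean_space L2 \<Rightarrow> 'a L2) = fourier_op (- 1)"
  unfolding fourier_L2_def
proof (rule the_equality)
  show "bounded_linear (fourier_op (- 1) :: 'a L2 \<Rightarrow> 'a L2) \<and>
      (\<forall>f::'a \<Rightarrow> complex. integrable lebesgue f \<and> square_integrable f \<longrightarrow> fourier_op (- 1) (abs_L2 f) = abs_L2 (fourier_integral f))"
    by (auto simp: fourier_integral_eq fourier_op_abs bounded_linear_fourier_op)
next
  fix G :: "'a L2 \<Rightarrow> 'a L2"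
  assume G: "bounded_linear G \<and>
      (\<forall>f. integrable lebesgue f \<and> square_integrable f \<longrightarrow> G (abs_L2 f) = abs_L2 (fourier_integral f))"
  show "G = fourier_op (- 1)"
  proof
    fix f :: "'a L2"
    note tr = L2_truncation_dense[of "rep_L2 f", OF square_integrable_rep_L2]
    have "(\<lambda>n. G (abs_L2 (trunc n (rep_L2 f)))) \<longlonglongrightarrow> G (abs_L2 (rep_L2 f))"
      using G by (intro bounded_linear.tendsto[of G] tr) auto
    then have "(\<lambda>n. abs_L2 (fourier_int (- 1) (trunc n (rep_L2 f)))) \<longlonglongrightarrow> G f"
      using G tr(1,2) by (simp add: fourier_integral_eq)
    then show "G f = fourier_op (- 1) f"
      by (rule LIMSEQ_unique[OF _ fourier_op_LIMSEQ]) simp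
  qed
qed

section \<open>Inverse transform and Plancherel's identity\<close>

definition inverse_fourier_L2 :: "'a::euclidean_space L2 \<Rightarrow> 'a L2" where
  "inverse_fourier_L2 f = (1 / (2 * pi) ^ DIM('a)) *\<^sub>R fourier_op 1 f"

lemma bounded_linear_fourier_L2: "bounded_linear fourier_L2"
  by (simp add: fourier_L2_eq bounded_linear_fourier_op)

lemma bounded_linear_inverse_fourier_L2: "bounded_linear (inverse_fourier_L2 :: 'a::euclidean_space L2 \<Rightarrow> 'a L2)"
  unfolding inverse_fourier_L2_def
  by (intro bounded_linear_compose[OF bounded_linear_scaleR_right] bounded_linear_fourier_op) simp

lemma inverse_fourier_L2_left [simp]: "inverse_fourier_L2 (fourier_L2 f) = f"
  using fourier_op_inversion[of "- 1" f] by (simp add: inverse_fourier_L2_def fourier_L2_eq)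

lemma inverse_fourier_L2_right [simp]: "fourier_L2 (inverse_fourier_L2 f) = f"
  using fourier_op_inversion[of 1 f] linear_cmul[OF bounded_linear.linear[OF bounded_linear_fourier_op[of "- 1"]], of _ "fourier_op 1 f"]
  by (simp add: inverse_fourier_L2_def fourier_L2_eq)

text \<open>The lower bound is the upper bound for the opposite sign, applied to the transform of
  \<open>f\<close> and combined with the inversion formula.\<close>

lemma norm_fourier_L2:
  fixes f :: "'a::euclidean_space L2"
  shows "norm (fourier_L2 f) = sqrt ((2 * pi) ^ DIM('a)) * norm f"
proof (rule antisym)
  let ?C = "(2 * pi) ^ DIM('a)"
  show "norm (fourier_L2 f) \<le> sqrt ?C * norm f"
    unfolding fourier_L2_eq by (rule norm_fourier_op_le) simp
  have "sqrt ?C * sqrt ?C * norm f = norm (fourier_op 1 (fourier_L2 f))"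
    using fourier_op_inversion[of "- 1" f] by (simp add: fourier_L2_eq)
  also have "\<dots> \<le> sqrt ?C * norm (fourier_L2 f)"
    by (rule norm_fourier_op_le) simp
  finally have "sqrt ?C * (sqrt ?C * norm f) \<le> sqrt ?C * norm (fourier_L2 f)"
    by (simp only: mult.assoc)
  moreover have "0 < sqrt ?C"
    by simp
  ultimately show "sqrt ?C * norm f \<le> norm (fourier_L2 f)"
    by (metis mult_le_cancel_left_pos)
qed

section \<open>Fourier multipliers and the nonlinearity\<close>

definition mult_L2 :: "('a::euclidean_space \<Rightarrow> complex) \<Rightarrow> 'a L2 \<Rightarrow> 'a L2" where
  "mult_L2 m f = abs_L2 (\<lambda>x. m x * rep_L2 f x)"

definition bounded_symbol :: "('a::euclidean_space \<Rightarrow> complex) \<Rightarrow> bool" where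
  "bounded_symbol m \<longleftrightarrow> m \<in> borel_measurable lebesgue \<and> bounded (range m)"

lemma bounded_symbol_measurable [measurable_dest]:
  "bounded_symbol m \<Longrightarrow> m \<in> borel_measurable lebesgue"
  by (simp add: bounded_symbol_def)

lemma bounded_symbolI:
  "m \<in> borel_measurable lebesgue \<Longrightarrow> (\<And>x. cmod (m x) \<le> B) \<Longrightarrow> bounded_symbol m"
  by (auto simp: bounded_symbol_def bounded_iff)

lemma square_integrable_mult:
  assumes m: "bounded_symbol m" and "square_integrable f"
  shows "square_integrable (\<lambda>x. m x * f x)"
proof -
  have [measurable]: "m \<in> borel_measurable lebesgue" "f \<in> borel_measurable lebesgue"
    using assms by auto
  obtain B where B: "\<And>x. cmod (m x) \<le> B"
    using m by (auto simp: bounded_symbol_def bounded_iff)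
  show ?thesis
  proof (rule square_integrable_bound(1)[OF assms(2)])
    show "AE x in lebesgue. cmod (m x * f x) \<le> B * cmod (f x)"
      using B by (auto simp: norm_mult intro!: mult_right_mono)
    show "0 \<le> B"
      using B norm_ge_zero by (rule order_trans[rotated])
  qed measurable
qed

lemma rep_mult_L2:
  "bounded_symbol m \<Longrightarrow> AE x in lebesgue. rep_L2 (mult_L2 m f) x = m x * rep_L2 f x"
  unfolding mult_L2_def by (rule rep_abs_L2) (simp add: square_integrable_mult)

lemma norm_mult_L2_le:
  assumes m: "m \<in> borel_measurable lebesgue" and B: "\<And>x. cmod (m x) \<le> B"
  shows "norm (mult_L2 m f) \<le> B * norm f"
proof -
  have "norm (mult_L2 m f) = L2_norm (\<lambda>x. m x * rep_L2 f x)"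
    unfolding mult_L2_def using bounded_symbolI[OF assms]
    by (intro norm_abs_L2 square_integrable_mult) auto
  also have "\<dots> \<le> B * L2_norm (rep_L2 f)"
  proof (rule square_integrable_bound(2))
    show "AE x in lebesgue. cmod (m x * rep_L2 f x) \<le> B * cmod (rep_L2 f x)"
      using B by (auto simp: norm_mult intro!: mult_right_mono)
    show "0 \<le> B"
      using B norm_ge_zero by (rule order_trans[rotated])
  qed (use m in auto)
  finally show ?thesis
    by (simp add: norm_L2_rep)
qed

lemma bounded_linear_mult_L2:
  assumes m: "bounded_symbol m"
  shows "bounded_linear (mult_L2 m)"
proof -
  obtain B where B: "\<And>x. cmod (m x) \<le> B"
    using m by (auto simp: bounded_symbol_def bounded_iff)
  show ?thesis
  proof (rule bounded_linear_intro)
    fix f g :: "'a L2" and r :: real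
    show "mult_L2 m (f + g) = mult_L2 m f + mult_L2 m g"
      unfolding L2_eq_iff
      using rep_mult_L2[OF m, of "f + g"] rep_mult_L2[OF m, of f] rep_mult_L2[OF m, of g]
        rep_L2_add[of "mult_L2 m f" "mult_L2 m g"] rep_L2_add[of f g]
      by eventually_elim (simp add: distrib_left)
    show "mult_L2 m (r *\<^sub>R f) = r *\<^sub>R mult_L2 m f"
      unfolding L2_eq_iff
      using rep_mult_L2[OF m, of "r *\<^sub>R f"] rep_mult_L2[OF m, of f]
        rep_L2_scaleR[of r "mult_L2 m f"] rep_L2_scaleR[of r f]
      by eventually_elim simp
    show "norm (mult_L2 m f) \<le> norm f * B"
      using norm_mult_L2_le[of m B f] m B by (simp add: bounded_symbol_def mult.commute)
  qed
qed

lemma mult_L2_mult_L2: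
  assumes "bounded_symbol m" "bounded_symbol k" "bounded_symbol (\<lambda>x. m x * k x)"
  shows "mult_L2 m (mult_L2 k f) = mult_L2 (\<lambda>x. m x * k x) f"
  unfolding L2_eq_iff
  using rep_mult_L2[OF assms(1), of "mult_L2 k f"] rep_mult_L2[OF assms(2), of f] rep_mult_L2[OF assms(3), of f]
  by eventually_elim simp

text \<open>The condition that describes \<open>multiplier\<close> prescribes the Fourier transform
  of \<open>g\<close> almost everywhere; bijectivity of \<open>fourier_L2\<close> turns it into an
  explicit equation for \<open>g\<close>, so exactly one class satisfies it.\<close>

lemma fourier_multiplier:
  assumes m: "bounded_symbol m"
  shows "fourier_L2 (multiplier m f) = mult_L2 m (fourier_L2 f)"
proof -
  have eq: "(AE \<xi> in lebesgue. rep_L2 (fourier_L2 g) \<xi> = m \<xi> * rep_L2 (fourier_L2 f) \<xi>)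
      \<longleftrightarrow> g = inverse_fourier_L2 (mult_L2 m (fourier_L2 f))" for g
  proof -
    have "(AE \<xi> in lebesgue. rep_L2 (fourier_L2 g) \<xi> = m \<xi> * rep_L2 (fourier_L2 f) \<xi>)
        \<longleftrightarrow> (AE \<xi> in lebesgue. rep_L2 (fourier_L2 g) \<xi> = rep_L2 (mult_L2 m (fourier_L2 f)) \<xi>)"
      using rep_mult_L2[OF m, of "fourier_L2 f"] by (intro eventually_cong) auto
    also have "\<dots> \<longleftrightarrow> fourier_L2 g = mult_L2 m (fourier_L2 f)"
      by (rule L2_eq_iff[symmetric])
    also have "\<dots> \<longleftrightarrow> g = inverse_fourier_L2 (mult_L2 m (fourier_L2 f))"
      by (metis inverse_fourier_L2_left inverse_fourier_L2_right)
    finally show ?thesis .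
  qed
  show ?thesis
    unfolding multiplier_def eq by simp
qed

lemma multiplier_eq:
  "bounded_symbol m \<Longrightarrow> multiplier m f = inverse_fourier_L2 (mult_L2 m (fourier_L2 f))"
  by (metis fourier_multiplier inverse_fourier_L2_left)

lemma bounded_linear_multiplier:
  assumes "bounded_symbol m"
  shows "bounded_linear (multiplier m)"
  unfolding multiplier_eq[OF assms, abs_def]
  by (intro bounded_linear_compose[OF bounded_linear_inverse_fourier_L2]
      bounded_linear_compose[OF bounded_linear_mult_L2[OF assms]] bounded_linear_fourier_L2)

lemma norm_multiplier_le:
  fixes f :: "'a::euclidean_space L2"
  assumes "m \<in> borel_measurable lebesgue" "\<And>x. cmod (m x) \<le> B"
  shows "norm (multiplier m f) \<le> B * norm f"
proof -
  have "sqrt ((2 * pi) ^ DIM('a)) * norm (multiplier m f) = norm (mult_L2 m (fourier_L2 f))"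
    using bounded_symbolI[OF assms] by (simp only: fourier_multiplier flip: norm_fourier_L2)
  also have "\<dots> \<le> B * norm (fourier_L2 f)"
    by (rule norm_mult_L2_le[OF assms])
  also have "\<dots> = sqrt ((2 * pi) ^ DIM('a)) * (B * norm f)"
    by (simp add: norm_fourier_L2)
  finally show ?thesis
    by (rule mult_left_le_imp_le) simp
qed

lemma multiplier_multiplier:
  assumes "bounded_symbol m" "bounded_symbol k" "bounded_symbol (\<lambda>x. m x * k x)"
  shows "multiplier m (multiplier k f) = multiplier (\<lambda>x. m x * k x) f"
  using assms by (simp add: multiplier_eq mult_L2_mult_L2)

lemma multiplier_one:
  fixes f :: "'a::euclidean_space L2"
  shows "multiplier (\<lambda>x. 1) f = f"
proof -
  have "bounded_symbol (\<lambda>x::'a. 1)"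
    by (rule bounded_symbolI[of _ 1]) auto
  then show ?thesis
    by (simp add: multiplier_eq mult_L2_def)
qed

text \<open>Dominated convergence on the Fourier side: pointwise convergence of uniformly bounded
  symbols gives strong convergence of the operators. This yields the strong continuity of the
  propagator.\<close>

lemma multiplier_tendsto:
  fixes f :: "'a::euclidean_space L2"
  assumes [measurable]: "\<And>n. m n \<in> borel_measurable lebesgue" "k \<in> borel_measurable lebesgue"
    and B: "\<And>n x. cmod (m n x) \<le> B"
    and lim: "\<And>x. (\<lambda>n. m n x) \<longlonglongrightarrow> k x"
  shows "(\<lambda>n. multiplier (m n) f) \<longlonglongrightarrow> multiplier k f"
proof -
  have k: "cmod (k x) \<le> B" for x
    by (rule LIMSEQ_le_const2[OF tendsto_norm[OF lim]]) (use B in auto)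
  have sm: "bounded_symbol (m n)" for n
    by (rule bounded_symbolI[OF _ B]) simp
  have sk: "bounded_symbol k"
    by (rule bounded_symbolI[OF _ k]) simp
  let ?f = "rep_L2 (fourier_L2 f)"
  have "(\<lambda>n. abs_L2 (\<lambda>x. m n x * ?f x)) \<longlonglongrightarrow> abs_L2 (\<lambda>x. k x * ?f x)"
  proof (rule L2_dominated_convergence(3))
    show "square_integrable (\<lambda>x. of_real B * ?f x)"
      by (intro square_integrable_scale) simp
    show "AE x in lebesgue. (\<lambda>n. m n x * ?f x) \<longlonglongrightarrow> k x * ?f x"
      by (intro AE_I2 tendsto_intros lim)
    show "AE x in lebesgue. cmod (m n x * ?f x) \<le> cmod (of_real B * ?f x)" for n
    proof (rule AE_I2)
      fix x
      have "cmod (m n x) * cmod (?f x) \<le> \<bar>B\<bar> * cmod (?f x)"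
        using B[of n x] by (intro mult_right_mono) auto
      then show "cmod (m n x * ?f x) \<le> cmod (of_real B * ?f x)"
        by (simp add: norm_mult)
    qed
  qed auto
  then have "(\<lambda>n. inverse_fourier_L2 (mult_L2 (m n) (fourier_L2 f))) \<longlonglongrightarrow> inverse_fourier_L2 (mult_L2 k (fourier_L2 f))"
    unfolding mult_L2_def by (rule bounded_linear.tendsto[OF bounded_linear_inverse_fourier_L2])
  then show ?thesis
    by (simp add: multiplier_eq sm sk)
qed

section \<open>Bernstein's inequality\<close>

lemma L2_Cauchy_Schwarz:
  assumes f: "square_integrable f" and g: "square_integrable g"
  shows "integrable lebesgue (\<lambda>x. f x * g x)"
    and "(LINT x|lebesgue. cmod (f x * g x)) \<le> L2_norm f * L2_norm g"
proof -
  have [measurable]: "f \<in> borel_measurable lebesgue" "g \<in> borel_measurable lebesgue"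
    using assms by auto
  have "(\<integral>\<^sup>+x. ennreal (cmod (f x * g x)) \<partial>lebesgue)\<^sup>2
      \<le> (\<integral>\<^sup>+x. (ennreal (cmod (f x)))\<^sup>2 \<partial>lebesgue) * (\<integral>\<^sup>+x. (ennreal (cmod (g x)))\<^sup>2 \<partial>lebesgue)"
    using Cauchy_Schwarz_nn_integral[of "\<lambda>x. ennreal (cmod (f x))" lebesgue "\<lambda>x. ennreal (cmod (g x))"]
    by (simp add: norm_mult ennreal_mult)
  also have "\<dots> = (ennreal (L2_norm f * L2_norm g))\<^sup>2"
    using assms by (simp add: ennreal_power flip: L2_norm_nn_integral ennreal_mult power_mult_distrib)
  finally have le: "(\<integral>\<^sup>+x. ennreal (cmod (f x * g x)) \<partial>lebesgue) \<le> ennreal (L2_norm f * L2_norm g)"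
    by (cases "\<integral>\<^sup>+x. ennreal (cmod (f x * g x)) \<partial>lebesgue")
      (auto simp: ennreal_power power2_le_iff_abs_le ennreal_le_iff top_unique)
  then show int: "integrable lebesgue (\<lambda>x. f x * g x)"
    unfolding integrable_iff_bounded by (auto intro: le_less_trans)
  have "ennreal (LINT x|lebesgue. cmod (f x * g x)) = (\<integral>\<^sup>+x. ennreal (cmod (f x * g x)) \<partial>lebesgue)"
    using int by (intro nn_integral_eq_integral[symmetric] integrable_norm) auto
  then have "ennreal (LINT x|lebesgue. cmod (f x * g x)) \<le> ennreal (L2_norm f * L2_norm g)"
    using le by simp
  then show "(LINT x|lebesgue. cmod (f x * g x)) \<le> L2_norm f * L2_norm g"
    by (subst (asm) ennreal_le_iff) auto
qed

text \<open>Bernstein's inequality: on the Fourier side, \<open>m f\<close> is integrable by Cauchy--Schwarz.\<close>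

lemma multiplier_AE_bounded:
  fixes m :: "'a::euclidean_space \<Rightarrow> complex"
  assumes m: "bounded_symbol m" "square_integrable m"
  shows "\<exists>K\<ge>0. \<forall>f. AE x in lebesgue. cmod (rep_L2 (multiplier m f) x) \<le> K * norm f"
proof -
  define C where "C = (2 * pi) ^ DIM('a)"
  have "C > 0"
    by (simp add: C_def)
  \<comment> \<open>\<open>sqrt C\<close> stems from Plancherel's identity, the division by
    \<open>C\<close> from the inverse transform.\<close>
  define K where "K = L2_norm m * sqrt C / C"
  have "AE x in lebesgue. cmod (rep_L2 (multiplier m f) x) \<le> K * norm f" for f
  proof -
    let ?g = "\<lambda>\<xi>. m \<xi> * rep_L2 (fourier_L2 f) \<xi>"
    have [measurable]: "m \<in> borel_measurable lebesgue"
      using m by auto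
    have si: "square_integrable ?g"
      by (rule square_integrable_mult[OF m(1)]) simp
    have i: "integrable lebesgue (\<lambda>\<xi>. (cmod (m \<xi>))\<^sup>2)" "integrable lebesgue (\<lambda>\<xi>. (cmod (rep_L2 (fourier_L2 f) \<xi>))\<^sup>2)"
      using m(2) square_integrable_rep_L2[of "fourier_L2 f"] by (auto simp: square_integrable_def)
    have int: "integrable lebesgue ?g"
      by (rule L2_Cauchy_Schwarz(1)[OF m(2)]) simp
    have "(LINT \<xi>|lebesgue. cmod (?g \<xi>)) \<le> L2_norm m * norm (fourier_L2 f)"
      unfolding norm_L2_rep by (rule L2_Cauchy_Schwarz(2)[OF m(2)]) simp
    then have bd: "(LINT \<xi>|lebesgue. cmod (?g \<xi>)) / C \<le> K * norm f"
      using \<open>C > 0\<close> unfolding K_def norm_fourier_L2 C_def[symmetric] by (simp add: field_simps)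
    have "multiplier m f = (1 / C) *\<^sub>R abs_L2 (fourier_int 1 ?g)"
      using fourier_op_abs[OF int si, of 1]
      by (simp add: multiplier_eq m inverse_fourier_L2_def mult_L2_def C_def)
    also have "\<dots> = abs_L2 (\<lambda>x. (1 / C) *\<^sub>R fourier_int 1 ?g x)"
      by (intro abs_L2_scaleR fourier_int_L2_bound int si) simp
    finally have eq: "multiplier m f = abs_L2 (\<lambda>x. (1 / C) *\<^sub>R fourier_int 1 ?g x)" .
    have "AE x in lebesgue. rep_L2 (multiplier m f) x = (1 / C) *\<^sub>R fourier_int 1 ?g x"
      unfolding eq by (intro rep_abs_L2 square_integrable_scaleR fourier_int_L2_bound int si) simp
    then show ?thesis
    proof eventually_elim
      case (elim x)
      have "cmod (rep_L2 (multiplier m f) x) = cmod (fourier_int 1 ?g x) / C"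
        using \<open>C > 0\<close> by (simp add: elim)
      also have "\<dots> \<le> (LINT \<xi>|lebesgue. cmod (?g \<xi>)) / C"
        using \<open>C > 0\<close> by (intro divide_right_mono fourier_int_bound int) simp
      also note bd
      finally show ?case .
    qed
  qed
  moreover have "K \<ge> 0"
    using \<open>C > 0\<close> by (simp add: K_def)
  ultimately show ?thesis
    by blast
qed

section \<open>Lipschitz estimate for the cubic map\<close>

lemma cubic_diff_bound:
  fixes a b :: complex
  assumes "cmod a \<le> p" "cmod b \<le> q"
  shows "cmod (of_real ((cmod a)\<^sup>2) * a - of_real ((cmod b)\<^sup>2) * b) \<le> 2 * (p\<^sup>2 + q\<^sup>2) * cmod (a - b)"
proof -
  let ?x = "cmod a" and ?y = "cmod b"
  \<comment> \<open>Splitting off (|a|^2 - |b|^2) b leaves a difference of moduli, which is at most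
    |a - b|.\<close>
  have "of_real (?x\<^sup>2) * a - of_real (?y\<^sup>2) * b = of_real (?x\<^sup>2) * (a - b) + of_real ((?x - ?y) * (?x + ?y)) * b"
    by (simp add: algebra_simps power2_eq_square)
  then have "cmod (of_real (?x\<^sup>2) * a - of_real (?y\<^sup>2) * b) \<le> ?x\<^sup>2 * cmod (a - b) + \<bar>?x - ?y\<bar> * (?x + ?y) * ?y"
    by (metis (no_types, opaque_lifting) norm_triangle_ineq norm_mult norm_of_real abs_mult abs_power2 abs_of_nonneg add_nonneg_nonneg norm_ge_zero)
  also have "\<dots> \<le> ?x\<^sup>2 * cmod (a - b) + cmod (a - b) * (?x + ?y) * ?y"
    by (intro add_left_mono mult_right_mono norm_triangle_ineq3) auto
  also have "\<dots> = (?x\<^sup>2 + ?x * ?y + ?y\<^sup>2) * cmod (a - b)"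
    by (simp add: algebra_simps power2_eq_square)
  also have "\<dots> \<le> (2 * (p\<^sup>2 + q\<^sup>2)) * cmod (a - b)"
  proof (rule mult_right_mono)
    have "?x\<^sup>2 \<le> p\<^sup>2" "?y\<^sup>2 \<le> q\<^sup>2" "?x * ?y \<ge> 0"
      using assms by (auto intro: power_mono)
    then show "?x\<^sup>2 + ?x * ?y + ?y\<^sup>2 \<le> 2 * (p\<^sup>2 + q\<^sup>2)"
      using sum_squares_bound[of ?x ?y] zero_le_power2[of ?x] zero_le_power2[of ?y]
      unfolding mult.assoc distrib_left by linarith
  qed simp
  finally show ?thesis .
qed

text \<open>A pointwise bound makes |f|^2 f square integrable, so that \<open>cubic f\<close> is a
  genuine class; then the pointwise difference bound can be integrated.\<close>

lemma norm_cubic_diff_le: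
  assumes f: "AE x in lebesgue. cmod (rep_L2 f x) \<le> p" and g: "AE x in lebesgue. cmod (rep_L2 g x) \<le> q"
  shows "norm (cubic f - cubic g) \<le> 2 * (p\<^sup>2 + q\<^sup>2) * norm (f - g)"
proof -
  let ?c = "\<lambda>f x. of_real ((cmod (rep_L2 f x))\<^sup>2) * rep_L2 f x"
  have si: "square_integrable (?c h)" if "AE x in lebesgue. cmod (rep_L2 h x) \<le> r" for h r
  proof (rule square_integrable_bound(1))
    show "square_integrable (rep_L2 h)"
      by simp
    show "AE x in lebesgue. cmod (?c h x) \<le> r\<^sup>2 * cmod (rep_L2 h x)"
      using that by eventually_elim (auto simp: norm_mult norm_power intro!: mult_right_mono power_mono)
  qed auto
  have "norm (cubic f - cubic g) = L2_norm (\<lambda>x. ?c f x - ?c g x)"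
    unfolding cubic_def using si[OF f] si[OF g]
    by (simp only: abs_L2_diff norm_abs_L2 square_integrable_diff)
  also have "\<dots> \<le> (2 * (p\<^sup>2 + q\<^sup>2)) * L2_norm (rep_L2 (f - g))"
  proof (rule square_integrable_bound(2))
    show "AE x in lebesgue. cmod (?c f x - ?c g x) \<le> 2 * (p\<^sup>2 + q\<^sup>2) * cmod (rep_L2 (f - g) x)"
      using f g rep_L2_diff[of f g] by eventually_elim (simp only: cubic_diff_bound)
  qed auto
  finally show ?thesis
    by (simp add: norm_L2_rep)
qed

text \<open>The representative of 0 is picked by the quotient and is known to vanish only almost
  everywhere.\<close>

lemma cubic_zero: "cubic 0 = 0"
proof -
  have "AE x in lebesgue. rep_L2 (0 :: (real^2) L2) x = 0"
    unfolding zero_L2_def by (simp add: rep_abs_L2 square_integrable_zero)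
  then have "AE x in lebesgue. of_real ((cmod (rep_L2 (0 :: (real^2) L2) x))\<^sup>2) * rep_L2 (0 :: (real^2) L2) x = 0"
    by eventually_elim simp
  note z = this
  have "square_integrable (\<lambda>x. of_real ((cmod (rep_L2 (0 :: (real^2) L2) x))\<^sup>2) * rep_L2 (0 :: (real^2) L2) x)"
    by (rule square_integrable_bound(1)[OF square_integrable_zero, of _ 1]) (use z in auto)
  then show ?thesis
    unfolding cubic_def zero_L2_def[symmetric] using z
    by (simp add: zero_L2_def abs_L2_eq_iff square_integrable_zero)
qed

section \<open>Evolution equations with a cubic nonlinearity\<close>

text \<open>The abstract form of the problem: Duhamel's formula refers to the group and not to its
  generator, and the explicit quadratic growth of the Lipschitz constant lets the existence time
  depend on \<open>R\<close> and \<open>C\<close> alone.\<close>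

locale evolution =
  fixes S :: "real \<Rightarrow> 'b::banach \<Rightarrow> 'b" and N :: "'b \<Rightarrow> 'b" and C :: real
  assumes linear: "bounded_linear (S t)"
    and isometry: "norm (S t x) = norm x"
    and group: "S (s + t) x = S s (S t x)"
    and S_zero: "S 0 x = x"
    and strongly_continuous: "continuous_on UNIV (\<lambda>t. S t x)"
    and C_nonneg: "0 \<le> C"
    and N_Lipschitz: "norm (N x - N y) \<le> C * ((norm x)\<^sup>2 + (norm y)\<^sup>2) * norm (x - y)"
    and N_zero: "N 0 = 0"
begin

section \<open>Continuity of the flow and of the nonlinearity\<close>

lemma S_diff: "S t (x - y) = S t x - S t y"
  by (rule linear_diff[OF bounded_linear.linear[OF linear]])

lemma S_inverse [simp]: "S t (S (- t) x) = x" "S (- t) (S t x) = x"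
  by (simp_all flip: group add: S_zero)

text \<open>Strong continuity is upgraded to joint continuity: \<open>S (f s) (g s)\<close> is the
  sum of \<open>S (f s) (g t)\<close> and \<open>S (f s) (g s - g t)\<close>, and by isometry the
  second term is small whatever \<open>f s\<close> is.\<close>

lemma S_continuous:
  assumes "continuous_on A f" "continuous_on A g"
  shows "continuous_on A (\<lambda>t. S (f t) (g t))"
  unfolding continuous_on_def
proof
  fix t
  assume "t \<in> A"
  have f: "(f \<longlongrightarrow> f t) (at t within A)" and g: "(g \<longlongrightarrow> g t) (at t within A)"
    using assms \<open>t \<in> A\<close> by (auto simp: continuous_on_def)
  have "isCont (\<lambda>s. S s (g t)) (f t)"
    using strongly_continuous[of "g t"] by (simp add: continuous_on_eq_continuous_at)
  then have 1: "((\<lambda>s. S (f s) (g t)) \<longlongrightarrow> S (f t) (g t)) (at t within A)"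
    by (rule isCont_tendsto_compose[OF _ f])
  have "((\<lambda>s. norm (g s - g t)) \<longlongrightarrow> 0) (at t within A)"
    using g by (simp add: LIM_zero tendsto_norm_zero)
  then have 2: "((\<lambda>s. S (f s) (g s - g t)) \<longlongrightarrow> 0) (at t within A)"
    by (intro tendsto_norm_zero_cancel[of "\<lambda>s. S (f s) (g s - g t)"]) (simp add: isometry)
  show "((\<lambda>s. S (f s) (g s)) \<longlongrightarrow> S (f t) (g t)) (at t within A)"
    using tendsto_add[OF 1 2] by (simp add: S_diff)
qed

lemma norm_N_le: "norm (N x) \<le> C * norm x ^ 3"
  using N_Lipschitz[of x 0] by (simp add: N_zero power2_eq_square power3_eq_cube)

lemma N_Lipschitz_ball:
  assumes "norm x \<le> r" "norm y \<le> r"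
  shows "norm (N x - N y) \<le> 2 * C * r\<^sup>2 * norm (x - y)"
proof -
  have "C * ((norm x)\<^sup>2 + (norm y)\<^sup>2) * norm (x - y) \<le> C * (r\<^sup>2 + r\<^sup>2) * norm (x - y)"
    using assms C_nonneg by (intro mult_right_mono mult_left_mono add_mono power_mono) auto
  with N_Lipschitz[of x y] show ?thesis
    by simp
qed

lemma N_continuous:
  assumes "continuous_on A f"
  shows "continuous_on A (\<lambda>t. N (f t))"
proof -
  have "continuous_on UNIV N"
    unfolding continuous_on_def
  proof
    fix x :: 'b
    have "((\<lambda>y. C * ((norm y)\<^sup>2 + (norm x)\<^sup>2) * norm (y - x)) \<longlongrightarrow> C * ((norm x)\<^sup>2 + (norm x)\<^sup>2) * norm (x - x)) (at x)"
      by (intro tendsto_intros)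
    then have "((\<lambda>y. C * ((norm y)\<^sup>2 + (norm x)\<^sup>2) * norm (y - x)) \<longlongrightarrow> 0) (at x)"
      by simp
    then have "((\<lambda>y. N y - N x) \<longlongrightarrow> 0) (at x)"
      by (rule Lim_null_comparison[rotated]) (simp add: N_Lipschitz)
    then show "(N \<longlongrightarrow> N x) (at x)"
      by (rule LIM_zero_cancel)
  qed
  then show ?thesis
    using assms continuous_on_compose2 by blast
qed

text \<open>The nonlinearity in the interaction picture \<open>v t = S (- t) (u t)\<close>, in which the Duhamel formula
  becomes \<open>v t = u0 + integral {0..t} (\<lambda>s. G s (v s))\<close>.\<close>

definition G :: "real \<Rightarrow> 'b \<Rightarrow> 'b" where
  "G s x = S (- s) (N (S s x))"

lemma G_continuous: "continuous_on A v \<Longrightarrow> continuous_on A (\<lambda>s. G s (v s))"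
  unfolding G_def by (intro S_continuous N_continuous continuous_intros)

lemma norm_G_le:
  assumes "norm x \<le> r"
  shows "norm (G s x) \<le> C * r ^ 3"
proof -
  have "norm (G s x) \<le> C * norm x ^ 3"
    using norm_N_le[of "S s x"] by (simp add: G_def isometry)
  also have "\<dots> \<le> C * r ^ 3"
    using assms C_nonneg by (intro mult_left_mono power_mono) auto
  finally show ?thesis .
qed

lemma G_Lipschitz:
  "norm x \<le> r \<Longrightarrow> norm y \<le> r \<Longrightarrow> norm (G s x - G s y) \<le> 2 * C * r\<^sup>2 * norm (x - y)"
  using N_Lipschitz_ball[of "S s x" r "S s y"]
  by (simp add: G_def isometry flip: S_diff)

section \<open>Duhamel's formula and uniqueness\<close>

definition duhamel :: "real \<Rightarrow> 'b \<Rightarrow> (real \<Rightarrow> 'b) \<Rightarrow> bool" where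
  "duhamel T u0 u \<longleftrightarrow> (\<forall>t\<in>{0..<T}.
     ((\<lambda>s. S (t - s) (N (u s))) has_integral (u t - S t u0)) {0..t})"

text \<open>The bounded operators \<open>S (- t)\<close> and \<open>S t\<close> pass under the
  integral sign, and the group law merges the factors.\<close>

lemma duhamel_interaction:
  "duhamel T u0 u \<longleftrightarrow> (\<forall>t\<in>{0..<T}.
     ((\<lambda>s. G s (S (- s) (u s))) has_integral (S (- t) (u t) - u0)) {0..t})"
proof -
  have "((\<lambda>s. S (t - s) (N (u s))) has_integral (u t - S t u0)) {0..t}
      \<longleftrightarrow> ((\<lambda>s. G s (S (- s) (u s))) has_integral (S (- t) (u t) - u0)) {0..t}" for t
  proof
    assume "((\<lambda>s. S (t - s) (N (u s))) has_integral (u t - S t u0)) {0..t}"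
    from has_integral_linear[OF this linear[of "- t"]]
    show "((\<lambda>s. G s (S (- s) (u s))) has_integral (S (- t) (u t) - u0)) {0..t}"
      by (simp add: o_def G_def S_diff S_zero flip: group)
  next
    assume "((\<lambda>s. G s (S (- s) (u s))) has_integral (S (- t) (u t) - u0)) {0..t}"
    from has_integral_linear[OF this linear[of t]]
    show "((\<lambda>s. S (t - s) (N (u s))) has_integral (u t - S t u0)) {0..t}"
      by (simp add: o_def G_def S_diff S_zero flip: group)
  qed
  then show ?thesis
    by (simp add: duhamel_def)
qed

text \<open>A Gronwall argument: with \<open>K\<close> a Lipschitz constant of \<open>G\<close> along both functions, the maximum of
  \<open>exp (- 2 K t) * norm (v t - w t)\<close> is at most half of itself.\<close>

lemma interaction_unique:
  assumes v: "continuous_on {0..T} v" "\<And>t. t \<in> {0..T} \<Longrightarrow> ((\<lambda>s. G s (v s)) has_integral (v t - a)) {0..t}"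
    and w: "continuous_on {0..T} w" "\<And>t. t \<in> {0..T} \<Longrightarrow> ((\<lambda>s. G s (w s)) has_integral (w t - a)) {0..t}"
    and t: "t \<in> {0..T}"
  shows "v t = w t"
proof -
  have "bounded (v ` {0..T})" "bounded (w ` {0..T})"
    using v(1) w(1) by (auto intro: compact_imp_bounded compact_continuous_image)
  then obtain r1 r2 where r12: "\<And>t. t \<in> {0..T} \<Longrightarrow> norm (v t) \<le> r1" "\<And>t. t \<in> {0..T} \<Longrightarrow> norm (w t) \<le> r2"
    unfolding bounded_iff by blast
  define r where "r = max r1 r2"
  have r: "norm (v t) \<le> r" "norm (w t) \<le> r" if "t \<in> {0..T}" for t
    using r12[OF that] by (auto simp: r_def)
  \<comment> \<open>The Lipschitz constant of \<open>G\<close> on the ball of radius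
    \<open>r\<close>, made strictly positive by the summand 1.\<close>
  define K where "K = 2 * C * r\<^sup>2 + 1"
  have K: "K > 0"
    using C_nonneg by (simp add: K_def add_nonneg_pos)
  define D where "D t = exp (- 2 * K * t) * norm (v t - w t)" for t
  have "continuous_on {0..T} D"
    unfolding D_def by (intro continuous_intros v w)
  then obtain m where m: "m \<in> {0..T}" "\<And>t. t \<in> {0..T} \<Longrightarrow> D t \<le> D m"
    using continuous_attains_sup[of "{0..T}" D] t by auto
  have nd: "norm (v s - w s) = exp (2 * K * s) * D s" for s
    by (simp add: D_def exp_minus field_simps)
  have "((\<lambda>s. G s (v s) - G s (w s)) has_integral (v m - w m)) {0..m}"
    using has_integral_diff[OF v(2)[OF m(1)] w(2)[OF m(1)]] by simp
  \<comment> \<open>The exponent carries 2 K but the Lipschitz bound only K, so the antiderivative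
    has the factor 1/2 that closes the estimate.\<close>
  moreover have I: "((\<lambda>s. (K * D m) * exp (2 * K * s)) has_integral (D m / 2 * exp (2 * K * m) - D m / 2 * exp (2 * K * 0))) {0..m}"
    using m(1) K
    by (intro fundamental_theorem_of_calculus)
      (auto intro!: derivative_eq_intros simp flip: has_real_derivative_iff_has_vector_derivative)
  moreover have "norm (G s (v s) - G s (w s)) \<le> (K * D m) * exp (2 * K * s)" if "s \<in> {0..m}" for s
  proof -
    have s: "s \<in> {0..T}"
      using that m(1) by auto
    have "norm (G s (v s) - G s (w s)) \<le> 2 * C * r\<^sup>2 * norm (v s - w s)"
      by (rule G_Lipschitz[OF r[OF s]])
    also have "\<dots> \<le> K * norm (v s - w s)"
      by (intro mult_right_mono) (auto simp: K_def)
    also have "\<dots> \<le> K * (exp (2 * K * s) * D m)"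
      unfolding nd using K m(2)[OF s] by (intro mult_left_mono) auto
    finally show ?thesis
      by (simp add: mult_ac)
  qed
  ultimately have "norm (v m - w m) \<le> D m / 2 * exp (2 * K * m) - D m / 2 * exp (2 * K * 0)"
    using integral_norm_bound_integral[of "\<lambda>s. G s (v s) - G s (w s)" "{0..m}" "\<lambda>s. (K * D m) * exp (2 * K * s)"]
    by (simp only: integral_unique has_integral_integrable)
  \<comment> \<open>The dropped contribution of the lower limit is \<open>D m / 2\<close>, which is
    nonnegative.\<close>
  also have "\<dots> \<le> D m / 2 * exp (2 * K * m)"
    by (simp add: D_def)
  finally have "exp (2 * K * m) * D m \<le> exp (2 * K * m) * (D m / 2)"
    by (simp add: nd mult_ac)
  then have "D m \<le> D m / 2"
    by (simp only: mult_le_cancel_left_pos exp_gt_zero)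
  then have "D m \<le> 0"
    by simp
  then have "D t \<le> 0"
    using m(2)[OF t] by simp
  then show ?thesis
    by (simp add: D_def mult_le_0_iff)
qed

text \<open>The fixed point iteration is run on bounded continuous functions on the whole line; clamping the upper
  limit of the integral to \<open>[0, T]\<close> keeps the iterates bounded.\<close>

definition picard :: "real \<Rightarrow> 'b \<Rightarrow> (real \<Rightarrow>\<^sub>C 'b) \<Rightarrow> real \<Rightarrow> 'b" where
  "picard T a v t = a + integral {0..max 0 (min t T)} (\<lambda>s. G s (v s))"

section \<open>Existence by contraction\<close>

lemma G_integrable: "continuous_on {a..b} v \<Longrightarrow> (\<lambda>s. G s (v s)) integrable_on {a..b}"
  by (intro integrable_continuous_real G_continuous)

text \<open>The indefinite integral is continuous on the compact interval and hence bounded there;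
  composition with the clamp carries both properties to the whole line.\<close>

lemma picard_bcontfun:
  assumes "T \<ge> 0"
  shows "picard T a v \<in> bcontfun"
proof -
  have *: "continuous_on {0..T} (\<lambda>t. a + integral {0..t} (\<lambda>s. G s (v s)))"
    by (intro continuous_intros indefinite_integral_continuous_1 G_integrable) simp
  have c: "continuous_on UNIV (picard T a v)"
    unfolding picard_def
    by (rule continuous_on_compose2[OF *, of _ "\<lambda>t. max 0 (min t T)"])
      (use assms in \<open>auto intro!: continuous_intros\<close>)
  have "bounded ((\<lambda>t. a + integral {0..t} (\<lambda>s. G s (v s))) ` {0..T})"
    using * by (intro compact_imp_bounded compact_continuous_image) auto
  then have "bounded (range (picard T a v))"
    by (rule bounded_subset) (use assms in \<open>auto simp: picard_def\<close>)
  with c show ?thesis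
    by (simp add: bcontfun_def)
qed

lemma integral_G_bound:
  assumes "0 \<le> t" "t \<le> T" "\<And>s. norm (v s) \<le> r" "continuous_on UNIV v"
  shows "norm (integral {0..t} (\<lambda>s. G s (v s))) \<le> T * (C * r ^ 3)"
proof -
  have "norm (integral {0..t} (\<lambda>s. G s (v s))) \<le> C * r ^ 3 * (t - 0)"
    using assms by (intro integral_bound G_continuous norm_G_le) (auto intro: continuous_on_subset)
  also have "\<dots> \<le> C * r ^ 3 * T"
    using assms C_nonneg order_trans[OF norm_ge_zero assms(3)] by (intro mult_left_mono) auto
  finally show ?thesis
    by (simp add: mult_ac)
qed

lemma integral_G_diff_bound:
  assumes "0 \<le> t" "t \<le> T" "\<And>s. norm (v s) \<le> r" "\<And>s. norm (w s) \<le> r"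
    "continuous_on UNIV v" "continuous_on UNIV w" "\<And>s. norm (v s - w s) \<le> d"
  shows "norm (integral {0..t} (\<lambda>s. G s (v s)) - integral {0..t} (\<lambda>s. G s (w s))) \<le> T * (2 * C * r\<^sup>2) * d"
proof -
  have vw: "continuous_on {0..t} v" "continuous_on {0..t} w"
    using assms by (auto intro: continuous_on_subset)
  have "integral {0..t} (\<lambda>s. G s (v s)) - integral {0..t} (\<lambda>s. G s (w s))
      = integral {0..t} (\<lambda>s. G s (v s) - G s (w s))"
    by (intro Henstock_Kurzweil_Integration.integral_diff[symmetric] G_integrable vw)
  also have "norm \<dots> \<le> (2 * C * r\<^sup>2 * d) * (t - 0)"
  proof (rule integral_bound)
    show "continuous_on {0..t} (\<lambda>s. G s (v s) - G s (w s))"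
      by (intro continuous_intros G_continuous vw)
    show "norm (G s (v s) - G s (w s)) \<le> 2 * C * r\<^sup>2 * d" for s
      using G_Lipschitz[OF assms(3,4), of s s s] mult_left_mono[OF assms(7), of "2 * C * r\<^sup>2" s] C_nonneg
      by simp
  qed (use assms in auto)
  also have "\<dots> \<le> (2 * C * r\<^sup>2 * d) * T"
    using assms C_nonneg order_trans[OF norm_ge_zero assms(7)] by (intro mult_left_mono) auto
  finally show ?thesis
    by (simp add: mult_ac)
qed

text \<open>\<open>V\<close> selects a fixed point for each datum, so that dependence on the datum
  can be measured in the space of bounded continuous functions; its values at data of norm above
  \<open>R\<close> are arbitrary.\<close>

lemma local_solution:
  assumes R: "R > 0"
  shows "\<exists>T>0. \<exists>V :: 'b \<Rightarrow> (real \<Rightarrow>\<^sub>C 'b).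
    (\<forall>a. norm a \<le> R \<longrightarrow> (\<forall>t\<in>{0..T}.
      ((\<lambda>s. G s (apply_bcontfun (V a) s)) has_integral (apply_bcontfun (V a) t - a)) {0..t})) \<and>
    (\<forall>a b. norm a \<le> R \<longrightarrow> norm b \<le> R \<longrightarrow> dist (V a) (V b) \<le> 2 * dist a b)"
proof -
  define r where "r = 2 * R"
  \<comment> \<open>Makes \<open>T\<close> times the Lipschitz constant of \<open>G\<close> on the
    ball of radius \<open>r\<close> at most 1/2; the summand 1 avoids a division by 0 when
    \<open>C = 0\<close>.\<close>
  define T where "T = 1 / (2 * (2 * C * r\<^sup>2 + 1))"
  have T: "T > 0"
    using C_nonneg by (auto simp: T_def intro!: divide_pos_pos add_nonneg_pos)
  have TC: "T * (2 * C * r\<^sup>2) \<le> 1 / 2"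
  proof -
    have "T * (2 * C * r\<^sup>2) \<le> T * (2 * C * r\<^sup>2 + 1)"
      using T by (intro mult_left_mono) auto
    also have "\<dots> = 1 / 2"
      using C_nonneg by (simp add: T_def add_nonneg_eq_0_iff)
    finally show ?thesis .
  qed
  \<comment> \<open>With r = 2 R, the growth bound C r^3 is the Lipschitz constant 2 C r^2 times R,
    so the same \<open>T\<close> keeps the integral within R; adding the datum stays within
    r.\<close>
  have TC3: "T * (C * r ^ 3) \<le> R"
  proof -
    have "T * (C * r ^ 3) = T * (2 * C * r\<^sup>2) * R"
      by (simp add: r_def power2_eq_square power3_eq_cube)
    also have "\<dots> \<le> 1 / 2 * R"
      using R by (intro mult_right_mono TC) auto
    finally show ?thesis
      using R by simp
  qed
  have bc: "picard T a v \<in> bcontfun" for a v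
    using T by (intro picard_bcontfun) simp
  define \<Phi> where "\<Phi> a v = Bcontfun (picard T a v)" for a v
  have \<Phi>: "apply_bcontfun (\<Phi> a v) = picard T a v" for a v
    using bc by (simp add: \<Phi>_def Bcontfun_inverse)
  define B where "B = {v :: real \<Rightarrow>\<^sub>C 'b. \<forall>t. norm (v t) \<le> r}"
  have clamp: "0 \<le> max 0 (min t T)" "max 0 (min t T) \<le> T" for t
    using T by auto
  have diff: "norm (picard T a v t - picard T b w t) \<le> norm (a - b) + 1 / 2 * dist v w"
    if "v \<in> B" "w \<in> B" for a b v w t
  proof -
    let ?I = "integral {0..max 0 (min t T)} (\<lambda>s. G s (v s)) - integral {0..max 0 (min t T)} (\<lambda>s. G s (w s))"
    have "norm ?I \<le> T * (2 * C * r\<^sup>2) * dist v w"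
      using that by (intro integral_G_diff_bound clamp) (auto simp: B_def dist_bounded simp flip: dist_norm)
    also have "\<dots> \<le> 1 / 2 * dist v w"
      by (intro mult_right_mono TC) simp
    finally have "norm ?I \<le> 1 / 2 * dist v w" .
    then show ?thesis
      using norm_triangle_ineq[of "a - b" ?I] by (simp add: picard_def algebra_simps)
  qed
  \<comment> \<open>Datum and iterate vary together: \<open>a = b\<close> gives the contraction, and
    inserting two fixed points gives the dependence on the datum.\<close>
  have contr: "dist (\<Phi> a v) (\<Phi> b w) \<le> norm (a - b) + 1 / 2 * dist v w" if "v \<in> B" "w \<in> B" for a b v w
    using diff[OF that] by (intro dist_bound) (simp only: \<Phi> dist_norm[of "picard _ _ _ _"])
  have B_closed: "closed B"
  proof -
    have "B = PiC UNIV (\<lambda>_. cball 0 r)"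
      by (auto simp: B_def mem_PiC_iff Pi_iff)
    then show ?thesis
      using closed_PiC[of UNIV "\<lambda>_. cball (0 :: 'b) r"] by simp
  qed
  have self: "\<Phi> a v \<in> B" if a: "norm a \<le> R" and v: "v \<in> B" for a v
  proof -
    have "norm (picard T a v t) \<le> R + R" for t
      unfolding picard_def
      by (intro norm_triangle_le add_mono a order_trans[OF integral_G_bound TC3] clamp)
        (use v in \<open>auto simp: B_def\<close>)
    then show ?thesis
      by (simp add: B_def \<Phi> r_def)
  qed
  have fixpoint: "\<exists>v. v \<in> B \<and> \<Phi> a v = v" if a: "norm a \<le> R" for a
  proof -
    have "\<exists>!v. v \<in> B \<and> \<Phi> a v = v"
    proof (rule Banach_fix[OF B_closed[folded complete_eq_closed]])
      show "B \<noteq> {}"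
        using R by (auto simp: B_def r_def intro!: exI[of _ "const_bcontfun 0"] simp: const_bcontfun.rep_eq)
      show "\<Phi> a ` B \<subseteq> B"
        using self[OF a] by auto
      show "dist (\<Phi> a v) (\<Phi> a w) \<le> 1 / 2 * dist v w" if "v \<in> B" "w \<in> B" for v w
        using contr[OF that, of a a] by simp
    qed auto
    then show ?thesis
      by blast
  qed
  then obtain V where V: "\<And>a. norm a \<le> R \<Longrightarrow> V a \<in> B" "\<And>a. norm a \<le> R \<Longrightarrow> \<Phi> a (V a) = V a"
    by metis
  show ?thesis
  proof (intro exI[of _ T] conjI exI[of _ V] allI impI ballI T)
    fix a :: 'b and t
    assume a: "norm a \<le> R" and t: "t \<in> {0..T}"
    have "V a t = picard T a (V a) t"
      using V(2)[OF a] \<Phi> by metis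
    then have "V a t - a = integral {0..t} (\<lambda>s. G s (V a s))"
      using t by (simp add: picard_def)
    then show "((\<lambda>s. G s (V a s)) has_integral (V a t - a)) {0..t}"
      by (simp add: G_integrable integrable_integral)
  next
    fix a b :: 'b
    assume ab: "norm a \<le> R" "norm b \<le> R"
    have "dist (V a) (V b) \<le> norm (a - b) + 1 / 2 * dist (V a) (V b)"
      using contr[OF V(1)[OF ab(1)] V(1)[OF ab(2)], of a b] by (simp add: V ab)
    then show "dist (V a) (V b) \<le> 2 * dist a b"
      by (simp add: dist_norm)
  qed
qed

section \<open>Well-posedness of the abstract equation\<close>

definition solution :: "real \<Rightarrow> 'b \<Rightarrow> (real \<Rightarrow> 'b) \<Rightarrow> bool" where
  "solution T u0 u \<longleftrightarrow> u \<in> extensional {0..<T} \<and> continuous_on {0..<T} u \<and> duhamel T u0 u"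

text \<open>Every solution is the free flow applied to the selected fixed point, by uniqueness in
  the interaction picture. The difference bound is inherited from the fixed points because the flow
  is isometric.\<close>

theorem well_posed:
  assumes R: "R > 0"
  shows "\<exists>T>0. (\<forall>a. norm a \<le> R \<longrightarrow> (\<exists>!u. solution T a u)) \<and>
    (\<forall>a b u w t. norm a \<le> R \<longrightarrow> norm b \<le> R \<longrightarrow> solution T a u \<longrightarrow> solution T b w \<longrightarrow>
      t \<in> {0..<T} \<longrightarrow> dist (u t) (w t) \<le> 2 * dist a b)"
proof -
  obtain T and V :: "'b \<Rightarrow> (real \<Rightarrow>\<^sub>C 'b)" where T: "T > 0"
    and V: "\<And>a t. norm a \<le> R \<Longrightarrow> t \<in> {0..T} \<Longrightarrow> ((\<lambda>s. G s (apply_bcontfun (V a) s)) has_integral (apply_bcontfun (V a) t - a)) {0..t}"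
    and Lip: "\<And>a b. norm a \<le> R \<Longrightarrow> norm b \<le> R \<Longrightarrow> dist (V a) (V b) \<le> 2 * dist a b"
    using local_solution[OF R] by metis
  have sol: "u t = S t (V a t)"
    if a: "norm a \<le> R" and sol: "solution T a u" and t: "t \<in> {0..<T}" for a u t
  proof -
    have u: "continuous_on {0..<T} u" "duhamel T a u"
      using sol by (auto simp: solution_def)
    have "S (- t) (u t) = V a t"
    proof (rule interaction_unique[where v="\<lambda>t. S (- t) (u t)" and T=t])
      show "continuous_on {0..t} (\<lambda>t. S (- t) (u t))"
        using t by (intro S_continuous continuous_intros continuous_on_subset[OF u(1)]) auto
      show "((\<lambda>s. G s (S (- s) (u s))) has_integral (S (- x) (u x) - a)) {0..x}" if "x \<in> {0..t}" for x
        using u(2) that t by (auto simp: duhamel_interaction)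
      show "((\<lambda>s. G s (V a s)) has_integral (V a x - a)) {0..x}" if "x \<in> {0..t}" for x
        using that t by (intro V a) auto
    qed (use t in auto)
    then show ?thesis
      by (metis S_inverse(1))
  qed
  show ?thesis
  proof (intro exI[of _ T] conjI T allI impI ballI)
    fix a :: 'b
    assume a: "norm a \<le> R"
    show "\<exists>!u. solution T a u"
    proof (rule ex1I)
      \<comment> \<open>Restriction fixes the values off the interval, as membership in
        \<open>extensional\<close> demands.\<close>
      let ?u = "restrict (\<lambda>t. S t (V a t)) {0..<T}"
      have "continuous_on {0..<T} (\<lambda>t. S t (V a t))"
        by (intro S_continuous continuous_intros) simp
      then have "continuous_on {0..<T} ?u"
        by (rule continuous_on_cong[THEN iffD1, rotated -1]) auto
      moreover have "duhamel T a ?u"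
        unfolding duhamel_interaction
      proof
        fix t
        assume t: "t \<in> {0..<T}"
        have "((\<lambda>s. G s (V a s)) has_integral (V a t - a)) {0..t}"
          using t by (intro V a) auto
        then show "((\<lambda>s. G s (S (- s) (?u s))) has_integral (S (- t) (?u t) - a)) {0..t}"
          using t by (subst has_integral_cong[of _ _ "\<lambda>s. G s (V a s)"]) auto
      qed
      ultimately show "solution T a ?u"
        by (simp add: solution_def)
    next
      fix u
      assume u: "solution T a u"
      show "u = restrict (\<lambda>t. S t (V a t)) {0..<T}"
        by (rule extensionalityI[of _ "{0..<T}"]) (use u sol[OF a u] in \<open>auto simp: solution_def\<close>)
    qed
  next
    fix a b :: 'b and u w t
    assume ab: "norm a \<le> R" "norm b \<le> R" and u: "solution T a u" and w: "solution T b w"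
      and t: "t \<in> {0..<T}"
    have "dist (u t) (w t) = dist (V a t) (V b t)"
      by (simp add: sol[OF ab(1) u t] sol[OF ab(2) w t] dist_norm isometry flip: S_diff)
    also have "\<dots> \<le> dist (V a) (V b)"
      by (rule dist_bounded)
    also have "\<dots> \<le> 2 * dist a b"
      by (rule Lip[OF ab])
    finally show "dist (u t) (w t) \<le> 2 * dist a b" .
  qed
qed

end

section \<open>The Cauchy problem\<close>

text \<open>In the constant \<open>a * (2 * K\<^sup>2) * b\<close>, the bounds \<open>a\<close> and
  \<open>b\<close> of the symbols \<open>A\<close> and \<open>p\<close> come from Plancherel's
  identity, and the two factors \<open>K\<close> are the pointwise bounds from Bernstein's
  inequality.\<close>

lemma evolution_cubic:
  fixes h :: "real^2 \<Rightarrow> real" and p A :: "real^2 \<Rightarrow> complex"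
  assumes h [measurable]: "h \<in> borel_measurable lebesgue"
    and p: "bounded_symbol p" "square_integrable p" and A: "bounded_symbol A"
  shows "\<exists>C. evolution (propagator h) (\<lambda>f. multiplier A (cubic (multiplier p f))) C"
proof -
  have e_measurable [measurable]: "(\<lambda>\<xi>. exp (\<i> * complex_of_real (t * h \<xi>))) \<in> borel_measurable lebesgue" for t
    by measurable
  have e_norm: "cmod (exp (\<i> * complex_of_real (t * h \<xi>))) \<le> 1" for t \<xi>
    by (simp add: norm_exp_i_times)
  have e: "bounded_symbol (\<lambda>\<xi>. exp (\<i> * complex_of_real (t * h \<xi>)))" for t
    by (rule bounded_symbolI[OF e_measurable e_norm])
  have le: "norm (propagator h t f) \<le> norm f" for t f
    using norm_multiplier_le[OF e_measurable e_norm] by (simp add: propagator_def)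
  have group: "propagator h (s + t) f = propagator h s (propagator h t f)" for s t f
  proof -
    have eq: "exp (\<i> * complex_of_real (s * h \<xi>)) * exp (\<i> * complex_of_real (t * h \<xi>))
        = exp (\<i> * complex_of_real ((s + t) * h \<xi>))" for \<xi>
      by (simp add: distrib_left distrib_right flip: exp_add)
    show ?thesis
      unfolding propagator_def using e by (subst multiplier_multiplier) (simp_all only: eq)
  qed
  have zero: "propagator h 0 f = f" for f
    by (simp add: propagator_def multiplier_one)
  obtain K where K: "K \<ge> 0" "\<And>f. AE x in lebesgue. cmod (rep_L2 (multiplier p f) x) \<le> K * norm f"
    using multiplier_AE_bounded[OF p] by blast
  obtain a where a: "\<And>x. cmod (A x) \<le> a"
    using A by (auto simp: bounded_symbol_def bounded_iff)
  obtain b where b: "\<And>x. cmod (p x) \<le> b"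
    using p by (auto simp: bounded_symbol_def bounded_iff)
  have ab: "0 \<le> a" "0 \<le> b"
    using order_trans[OF norm_ge_zero a] order_trans[OF norm_ge_zero b] by auto
  have diff: "multiplier m f - multiplier m g = multiplier m (f - g)" if "bounded_symbol m" for m and f g :: "(real^2) L2"
    using linear_diff[OF bounded_linear.linear[OF bounded_linear_multiplier[OF that]]] by simp
  have zero_mult: "multiplier m 0 = 0" if "bounded_symbol m" for m :: "real^2 \<Rightarrow> complex"
    using linear_0[OF bounded_linear.linear[OF bounded_linear_multiplier[OF that]]] by simp
  show ?thesis
  proof (intro exI[of _ "a * (2 * K\<^sup>2) * b"] evolution.intro)
    fix t s :: real and f g :: "(real^2) L2"
    show "bounded_linear (propagator h t)"
      unfolding propagator_def by (rule bounded_linear_multiplier[OF e])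
    show "norm (propagator h t f) = norm f"
    \<comment> \<open>The bound of the symbol by 1 gives one inequality; the reverse one is the same
      bound at time \<open>- t\<close>.\<close>
    proof (rule antisym[OF le])
      have "f = propagator h (- t) (propagator h t f)"
        using group[of "- t" t f] by (simp add: zero)
      then show "norm f \<le> norm (propagator h t f)"
        by (metis le)
    qed
    show "propagator h (s + t) f = propagator h s (propagator h t f)"
      by (rule group)
    show "propagator h 0 f = f"
      by (rule zero)
    \<comment> \<open>Continuity is tested on sequences, to match dominated convergence.\<close>
    show "continuous_on UNIV (\<lambda>t. propagator h t f)"
      unfolding continuous_on_sequentially o_def
    proof (intro allI ballI impI, elim conjE)
      fix x :: "nat \<Rightarrow> real" and t
      assume "x \<longlonglongrightarrow> t"
      then show "(\<lambda>n. propagator h (x n) f) \<longlonglongrightarrow> propagator h t f"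
        unfolding propagator_def
        by (intro multiplier_tendsto[where B=1] tendsto_intros e_measurable e_norm)
    qed
    show "0 \<le> a * (2 * K\<^sup>2) * b"
      using ab by simp
    show "multiplier A (cubic (multiplier p 0)) = 0"
      by (simp add: zero_mult p A cubic_zero)
    have "norm (multiplier A (cubic (multiplier p f)) - multiplier A (cubic (multiplier p g)))
        \<le> a * norm (cubic (multiplier p f) - cubic (multiplier p g))"
      unfolding diff[OF A] using A by (intro norm_multiplier_le a) (simp add: bounded_symbol_def)
    also have "\<dots> \<le> a * (2 * ((K * norm f)\<^sup>2 + (K * norm g)\<^sup>2) * norm (multiplier p f - multiplier p g))"
      by (intro mult_left_mono norm_cubic_diff_le K ab)
    also have "\<dots> \<le> a * (2 * ((K * norm f)\<^sup>2 + (K * norm g)\<^sup>2) * (b * norm (f - g)))"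
      unfolding diff[OF p(1)] using p(1) ab
      by (intro mult_left_mono norm_multiplier_le b) (auto simp: bounded_symbol_def)
    also have "\<dots> = a * (2 * K\<^sup>2) * b * ((norm f)\<^sup>2 + (norm g)\<^sup>2) * norm (f - g)"
      by (simp add: power_mult_distrib algebra_simps)
    finally show "norm (multiplier A (cubic (multiplier p f)) - multiplier A (cubic (multiplier p g)))
        \<le> a * (2 * K\<^sup>2) * b * ((norm f)\<^sup>2 + (norm g)\<^sup>2) * norm (f - g)" .
  qed
qed

lemma strong_solution_eq:
  assumes "evolution (propagator h) (\<lambda>f. multiplier A (cubic (P_le chi M f))) C"
  shows "strong_solution h A chi M = evolution.solution (propagator h) (\<lambda>f. multiplier A (cubic (P_le chi M f)))"
  by (auto simp: fun_eq_iff strong_solution_def C0_def evolution.solution_def[OF assms]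
      evolution.duhamel_def[OF assms])

theorem theorem1:
  fixes \<delta> :: real and \<beta> :: nat and \<gamma> :: "real \<Rightarrow> real"
    and h :: "real^2 \<Rightarrow> real" and M :: int and chi :: "real \<Rightarrow> real"
    and A :: "real^2 \<Rightarrow> complex"
  assumes "0 < \<delta>" "\<delta> < 1" and "\<beta> > 0"
    and "smooth_on {1 - \<delta><..<1 + \<delta>} \<gamma>"
    and "comparable_on {1 - \<delta><..<1 + \<delta>} (\<lambda>r. \<bar>deriv \<gamma> r\<bar>) (\<lambda>r. 1)"
    and "comparable_on {1 - \<delta><..<1 + \<delta>} (\<lambda>r. \<bar>deriv (deriv \<gamma>) r\<bar>) (\<lambda>r. \<bar>r - 1\<bar> ^ \<beta>)"
    and "h \<in> borel_measurable lebesgue"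
    and "\<And>\<xi> \<eta>. norm \<xi> = norm \<eta> \<Longrightarrow> h \<xi> = h \<eta>"
    and "\<And>\<xi>. norm \<xi> \<in> {1 - \<delta><..<1 + \<delta>} \<Longrightarrow> h \<xi> = \<gamma> (norm \<xi>)"
    and "M < -100" and "2 powi (M + 4) < \<delta>"
    and "smooth_on UNIV chi" and "range chi \<subseteq> {0..1}"
    and "\<And>r. \<bar>r\<bar> \<le> 1/2 \<Longrightarrow> chi r = 1" and "\<And>r. \<bar>r\<bar> \<ge> 3/4 \<Longrightarrow> chi r = 0"
    and "A \<in> borel_measurable lebesgue"
    and "\<exists>C. \<forall>\<xi>. norm \<xi> \<in> {1 - \<delta><..<1 + \<delta>} \<longrightarrow>
           cmod (A \<xi>) \<le> C * \<bar>norm \<xi> - 1\<bar> powr (real \<beta> / 2)"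
    and "closure {\<xi>. A \<xi> \<noteq> 0} \<subseteq> {\<xi>. 1 - 2 powi (M - 1) < norm \<xi> \<and> norm \<xi> < 1 + 2 powi (M - 1)}"
  shows "\<forall>R>0. \<exists>T>0.
      (\<forall>u0. norm u0 \<le> R \<longrightarrow> (\<exists>!u. strong_solution h A chi M T u0 u)) \<and>
      (\<exists>L\<ge>0. \<forall>u0\<in>cball 0 R. \<forall>v0\<in>cball 0 R.
         C0_dist T (solution_map h A chi M T u0) (solution_map h A chi M T v0)
           \<le> ereal (L * dist u0 v0))"
proof (intro allI impI)
  define p where "p \<xi> = complex_of_real (chi (2 powi (- M) * (norm \<xi> - 1)))" for \<xi> :: "real^2"
  have chi_measurable [measurable]: "chi \<in> borel_measurable borel"
  proof (rule borel_measurable_continuous_onI)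
    have "chi differentiable at r" for r
      using assms(12) by (auto simp: smooth_on_def dest: spec[of _ 0])
    then show "continuous_on UNIV chi"
      by (auto simp: continuous_on_eq_continuous_at intro: differentiable_imp_continuous_within)
  qed
  have p_measurable [measurable]: "p \<in> borel_measurable lebesgue"
    unfolding p_def by measurable
  have chi01: "0 \<le> chi r" "chi r \<le> 1" for r
    using assms(13) by (auto simp: subset_iff)
  have p_le: "cmod (p \<xi>) \<le> 1" for \<xi>
    using chi01 by (simp add: p_def)
  have p: "bounded_symbol p"
    by (rule bounded_symbolI[OF p_measurable p_le])
  \<comment> \<open>Beyond \<open>1 + 2 powi M\<close> the argument of \<open>chi\<close> is at
    least 1, hence above 3/4. Bounded with bounded support, \<open>p\<close> is square integrable,
    as Bernstein's inequality requires.\<close>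
  have p_supp: "p \<xi> = 0" if "norm \<xi> > 1 + 2 powi M" for \<xi>
  proof -
    have "2 powi (- M) * (norm \<xi> - 1) \<ge> 2 powi (- M) * 2 powi M"
      using that by (intro mult_left_mono) auto
    then have "2 powi (- M) * (norm \<xi> - 1) \<ge> 1"
      by (simp flip: power_int_add)
    then show ?thesis
      using assms(15) by (simp add: p_def)
  qed
  have p_si: "square_integrable p"
    unfolding square_integrable_def
  proof (intro conjI p_measurable)
    let ?B = "cball 0 (1 + 2 powi M) :: (real^2) set"
    have "emeasure lebesgue ?B < \<infinity>"
      using emeasure_lborel_cball_finite by simp
    then have "integrable lebesgue (indicator ?B :: real^2 \<Rightarrow> real)"
      by (intro integrable_real_indicator) auto
    then show "integrable lebesgue (\<lambda>\<xi>. (cmod (p \<xi>))\<^sup>2)"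
    proof (rule Bochner_Integration.integrable_bound)
      show "AE \<xi> in lebesgue. norm ((cmod (p \<xi>))\<^sup>2) \<le> norm (indicator ?B \<xi> :: real)"
      proof (rule AE_I2)
        fix \<xi> :: "real^2"
        show "norm ((cmod (p \<xi>))\<^sup>2) \<le> norm (indicator ?B \<xi> :: real)"
          using p_le[of \<xi>] p_supp[of \<xi>] by (cases "\<xi> \<in> ?B") (auto simp: power_le_one)
      qed
    qed measurable
  qed
  \<comment> \<open>The decay estimate is available only where the distance of
    \<open>norm \<xi>\<close> from 1 is below \<delta>. The support of \<open>A\<close> lies there,
    since \<open>2 powi (M - 1)\<close> is at most \<open>2 powi (M + 4)\<close>, which is below
    \<delta>; as \<delta> < 1, the power is then at most 1.\<close>
  have A: "bounded_symbol A"
  proof -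
    obtain C where C: "\<And>\<xi>. norm \<xi> \<in> {1 - \<delta><..<1 + \<delta>} \<Longrightarrow> cmod (A \<xi>) \<le> C * \<bar>norm \<xi> - 1\<bar> powr (real \<beta> / 2)"
      using assms(17) by blast
    have "cmod (A \<xi>) \<le> \<bar>C\<bar>" for \<xi>
    proof (cases "A \<xi> = 0")
      case False
      then have "\<xi> \<in> closure {\<xi>. A \<xi> \<noteq> 0}"
        using closure_subset[of "{\<xi>. A \<xi> \<noteq> 0}"] by blast
      then have "\<bar>norm \<xi> - 1\<bar> < 2 powi (M - 1)"
        using assms(18) by (auto simp: abs_less_iff)
      also have "(2 :: real) powi (M - 1) \<le> 2 powi (M + 4)"
        by (intro power_int_increasing) auto
      also note \<open>2 powi (M + 4) < \<delta>\<close>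
      finally have d: "\<bar>norm \<xi> - 1\<bar> < \<delta>" .
      have "cmod (A \<xi>) \<le> C * \<bar>norm \<xi> - 1\<bar> powr (real \<beta> / 2)"
        using d by (intro C) (auto simp: abs_less_iff)
      also have "\<dots> \<le> \<bar>C\<bar> * 1"
        using d assms(1-3) by (intro mult_mono powr_le1) auto
      finally show ?thesis
        by simp
    qed simp
    then show ?thesis
      by (rule bounded_symbolI[OF assms(16)])
  qed
  have P: "P_le chi M = multiplier p"
    by (simp add: fun_eq_iff P_le_def p_def[abs_def])
  \<comment> \<open>The concrete data now enter the existence time only through \<open>C\<close>, so
    \<open>T\<close> is the same for all initial values of norm at most \<open>R\<close>.\<close>
  obtain C where "evolution (propagator h) (\<lambda>f. multiplier A (cubic (multiplier p f))) C"
    using evolution_cubic[OF assms(7) p p_si A] by blast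
  then have E: "evolution (propagator h) (\<lambda>f. multiplier A (cubic (P_le chi M f))) C"
    by (simp add: P)
  fix R :: real
  assume "R > 0"
  obtain T where T: "T > 0"
    and ex: "\<And>u0. norm u0 \<le> R \<Longrightarrow> \<exists>!u. strong_solution h A chi M T u0 u"
    and Lip: "\<And>u0 v0 u v t. norm u0 \<le> R \<Longrightarrow> norm v0 \<le> R \<Longrightarrow> strong_solution h A chi M T u0 u \<Longrightarrow>
      strong_solution h A chi M T v0 v \<Longrightarrow> t \<in> {0..<T} \<Longrightarrow> dist (u t) (v t) \<le> 2 * dist u0 v0"
    using evolution.well_posed[OF E \<open>R > 0\<close>] unfolding strong_solution_eq[OF E] by metis
  have sol: "strong_solution h A chi M T u0 (solution_map h A chi M T u0)" if "norm u0 \<le> R" for u0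
    unfolding solution_map_def by (rule theI'[OF ex[OF that]])
  have "C0_dist T (solution_map h A chi M T u0) (solution_map h A chi M T v0) \<le> ereal (2 * dist u0 v0)"
    if "u0 \<in> cball 0 R" "v0 \<in> cball 0 R" for u0 v0
    unfolding C0_dist_def using that by (intro SUP_least) (auto intro!: Lip sol)
  then show "\<exists>T>0. (\<forall>u0. norm u0 \<le> R \<longrightarrow> (\<exists>!u. strong_solution h A chi M T u0 u)) \<and>
      (\<exists>L\<ge>0. \<forall>u0\<in>cball 0 R. \<forall>v0\<in>cball 0 R.
         C0_dist T (solution_map h A chi M T u0) (solution_map h A chi M T v0) \<le> ereal (L * dist u0 v0))"
    using T ex by (intro exI[of _ T] conjI exI[of _ 2]) auto
qed

end
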